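(* For all compositions $\eta,\gamma\in\mathbb{N}^n$, the coefficient $b_{\eta,\gamma}(\alpha)$ defined by the expansion $F_\eta^{r\delta}=\sum_\gamma\alpha^{|\gamma|-|\eta|}\,b_{\eta,\gamma}(\alpha)\,x^\gamma$ is a polynomial in $\mathbb{N}[\alpha]$.
   Context: Fix $n\ge1$. Let $r$ be an indeterminate, $\alpha=1/r$, and work in $\mathbb{Q}(r)[x_1,\dots,x_n]$. A composition is $\eta\in\mathbb{N}^n$ ($\mathbb{N}$ includes $0$), $|\eta|=\sum\eta_i$, $x^\eta=\prod x_i^{\eta_i}$; a partition is a weakly decreasing composition. Let $\delta=(n-1,\dots,1,0)$. Permutations $w\in S_n$ act on vectors by $(wv)_{w(i)}=v_i$. For a composition $\gamma$ let $w_\gamma$ be the permutation of minimal length such that $\gamma^+=w_\gamma^{-1}(\gamma)$ is a partition, and set $\overline{\gamma}=\gamma+w_\gamma(r\delta)$. It is known that for each composition $\eta$ there is a unique polynomial $E_\eta^{r\delta}$ of total degree $|\eta|$ with $E_\eta^{r\delta}(\overline\gamma)=0$ for all compositions $\gamma\ne\eta$ with $|\gamma|\le|\eta|$, and with coefficient of $x^\eta$ equal to $1$. For a box $(i,j)$ of $\eta$ (i.e. $1\le j\le \eta_i$) let $a_\eta(i,j)=\eta_i-j$ and $l_\eta(i,j)=\#\{k>i: j\le\eta_k\le\eta_i\}+\#\{k<i: j\le\eta_k+1\le\eta_i\}$, and $d_\eta(\alpha)=\prod_s(\alpha(a_\eta(s)+1)+l_\eta(s)+1)$ over all boxes $s$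 of $\eta$. Define $F_\eta^{r\delta}(x)=(-1)^{|\eta|}d_\eta(\alpha)E_\eta^{r\delta}(-x)$ and define $b_{\eta,\gamma}(\alpha)\in\mathbb{Q}(\alpha)$ by $F_\eta^{r\delta}=\sum_\gamma\alpha^{|\gamma|-|\eta|}b_{\eta,\gamma}(\alpha)x^\gamma$. *)

theory Defs
  imports
    "HOL-Library.Poly_Mapping"
    "HOL-Combinatorics.Permutations"
    "HOL-Computational_Algebra.Polynomial_Factorial"
begin

type_synonym Qr = "rat poly fract"

definition r_indet :: Qr where
  "r_indet = to_fract [:0, 1:]"

definition alpha :: Qr where
  "alpha = 1 / r_indet"

text \<open>
  Exponent vectors are finitely supported functions on the naturals; variables and positions are
  indexed by \<open>1, \<dots>, n\<close>, so compositions of length \<open>n\<close> are the exponent vectors supported there.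
\<close>

type_synonym expo = "nat \<Rightarrow>\<^sub>0 nat"

type_synonym 'a mpoly = "expo \<Rightarrow>\<^sub>0 'a"

definition composition :: "nat \<Rightarrow> expo \<Rightarrow> bool" where
  "composition n \<eta> \<longleftrightarrow> Poly_Mapping.keys \<eta> \<subseteq> {1..n}"

definition weight :: "expo \<Rightarrow> nat" where
  "weight \<eta> = (\<Sum>i\<in>Poly_Mapping.keys \<eta>. Poly_Mapping.lookup \<eta> i)"

definition mconst :: "'a::zero \<Rightarrow> 'a mpoly" where
  "mconst c = Poly_Mapping.single 0 c"

definition mvar :: "nat \<Rightarrow> 'a::zero_neq_one mpoly" where
  "mvar i = Poly_Mapping.single (Poly_Mapping.single i 1) 1"

definition polys_in :: "nat \<Rightarrow> 'a::zero mpoly set" where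
  "polys_in n = {p. \<forall>m\<in>Poly_Mapping.keys p. composition n m}"

definition total_degree :: "'a::zero mpoly \<Rightarrow> nat" where
  "total_degree p = Max (insert 0 (weight ` Poly_Mapping.keys p))"

text \<open>
  Substitution of \<open>f i\<close> for the \<open>i\<close>-th variable, with coefficients mapped by \<open>c\<close>: evaluation at a
  point for \<open>c = id\<close>, substitution of polynomials for \<open>c = mconst\<close>.
\<close>

definition subst_vars :: "('a::zero \<Rightarrow> 'b::comm_semiring_1) \<Rightarrow> (nat \<Rightarrow> 'b) \<Rightarrow> 'a mpoly \<Rightarrow> 'b" where
  "subst_vars c f p = (\<Sum>m\<in>Poly_Mapping.keys p. c (Poly_Mapping.lookup p m) * (\<Prod>i\<in>Poly_Mapping.keys m. f i ^ Poly_Mapping.lookup m i))"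

definition eval_at :: "(nat \<Rightarrow> 'a::comm_semiring_1) \<Rightarrow> 'a mpoly \<Rightarrow> 'a" where
  "eval_at v p = subst_vars id v p"

definition negate_vars :: "'a::comm_ring_1 mpoly \<Rightarrow> 'a mpoly" where
  "negate_vars p = subst_vars mconst (\<lambda>i. - mvar i) p"

text \<open>The action satisfies \<open>perm_act w v (w i) = v i\<close> for every permutation \<open>w\<close>.\<close>

definition perm_act :: "(nat \<Rightarrow> nat) \<Rightarrow> (nat \<Rightarrow> 'a) \<Rightarrow> nat \<Rightarrow> 'a" where
  "perm_act w v = v \<circ> inv w"

definition perm_length :: "nat \<Rightarrow> (nat \<Rightarrow> nat) \<Rightarrow> nat" where
  "perm_length n w = card {(i, j). i \<in> {1..n} \<and> j \<in> {1..n} \<and> i < j \<and> w j < w i}"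

definition weakly_decreasing :: "nat \<Rightarrow> (nat \<Rightarrow> nat) \<Rightarrow> bool" where
  "weakly_decreasing n v \<longleftrightarrow> (\<forall>i\<in>{1..n}. \<forall>j\<in>{1..n}. i \<le> j \<longrightarrow> v j \<le> v i)"

definition sorting_perm :: "nat \<Rightarrow> expo \<Rightarrow> nat \<Rightarrow> nat" where
  "sorting_perm n \<gamma> =
     (ARG_MIN (perm_length n) w. w permutes {1..n} \<and>
        weakly_decreasing n (perm_act (inv w) (Poly_Mapping.lookup \<gamma>)))"

definition r_delta :: "nat \<Rightarrow> nat \<Rightarrow> Qr" where
  "r_delta n i = r_indet * of_nat (n - i)"

definition shifted :: "nat \<Rightarrow> expo \<Rightarrow> nat \<Rightarrow> Qr" where
  "shifted n \<gamma> i = of_nat (Poly_Mapping.lookup \<gamma> i) + perm_act (sorting_perm n \<gamma>) (r_delta n) i"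

definition interp_E :: "nat \<Rightarrow> expo \<Rightarrow> Qr mpoly" where
  "interp_E n \<eta> =
     (THE p. p \<in> polys_in n \<and> total_degree p = weight \<eta> \<and>
        (\<forall>\<gamma>. composition n \<gamma> \<and> \<gamma> \<noteq> \<eta> \<and> weight \<gamma> \<le> weight \<eta> \<longrightarrow> eval_at (shifted n \<gamma>) p = 0) \<and>
        Poly_Mapping.lookup p \<eta> = 1)"

definition boxes :: "nat \<Rightarrow> expo \<Rightarrow> (nat \<times> nat) set" where
  "boxes n \<eta> = {(i, j). i \<in> {1..n} \<and> 1 \<le> j \<and> j \<le> Poly_Mapping.lookup \<eta> i}"

definition arm :: "expo \<Rightarrow> nat \<times> nat \<Rightarrow> nat" where
  "arm \<eta> = (\<lambda>(i, j). Poly_Mapping.lookup \<eta> i - j)"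

definition leg :: "nat \<Rightarrow> expo \<Rightarrow> nat \<times> nat \<Rightarrow> nat" where
  "leg n \<eta> = (\<lambda>(i, j).
     card {k \<in> {1..n}. k > i \<and> j \<le> Poly_Mapping.lookup \<eta> k \<and> Poly_Mapping.lookup \<eta> k \<le> Poly_Mapping.lookup \<eta> i} +
     card {k \<in> {1..n}. k < i \<and> j \<le> Poly_Mapping.lookup \<eta> k + 1 \<and> Poly_Mapping.lookup \<eta> k + 1 \<le> Poly_Mapping.lookup \<eta> i})"

definition hook_product :: "nat \<Rightarrow> expo \<Rightarrow> 'a::comm_semiring_1 \<Rightarrow> 'a" where
  "hook_product n \<eta> a =
     (\<Prod>s\<in>boxes n \<eta>. a * (of_nat (arm \<eta> s) + 1) + of_nat (leg n \<eta> s) + 1)"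

definition interp_F :: "nat \<Rightarrow> expo \<Rightarrow> Qr mpoly" where
  "interp_F n \<eta> =
     mconst ((-1) ^ weight \<eta> * hook_product n \<eta> alpha) * negate_vars (interp_E n \<eta>)"

definition b_coeff :: "nat \<Rightarrow> expo \<Rightarrow> expo \<Rightarrow> Qr" where
  "b_coeff n \<eta> \<gamma> = Poly_Mapping.lookup (interp_F n \<eta>) \<gamma> / alpha powi (int (weight \<gamma>) - int (weight \<eta>))"

lemma alpha_nonzero: "alpha \<noteq> 0"
  by (simp add: alpha_def r_indet_def)

lemma interp_F_expansion:
  "interp_F n \<eta> =
     (\<Sum>\<gamma>\<in>Poly_Mapping.keys (interp_F n \<eta>).
        Poly_Mapping.single \<gamma> (alpha powi (int (weight \<gamma>) - int (weight \<eta>)) * b_coeff n \<eta> \<gamma>))"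
proof -
  have "alpha powi (int (weight \<gamma>) - int (weight \<eta>)) * b_coeff n \<eta> \<gamma> = Poly_Mapping.lookup (interp_F n \<eta>) \<gamma>" for \<gamma>
    using alpha_nonzero by (simp add: b_coeff_def)
  then show ?thesis
    by (intro poly_mapping_eqI)
      (auto simp: lookup_sum lookup_single when_def sum.delta in_keys_iff)
qed

end

theory Submission
  imports Defs
begin

text \<open>
  Put \<open>B(x) = \<alpha>\<^bsup>|\<eta>|\<^esup> F\<^sub>\<eta>(x / \<alpha>)\<close>, whose coefficients are the \<open>b\<^sub>\<eta>\<^sub>,\<^sub>\<gamma>\<close>. The operators
  \<open>\<sigma>\<^sub>i = s\<^sub>i - (1 - s\<^sub>i) / (x\<^sub>i - x\<^sub>i\<^sub>+\<^sub>1)\<close> and \<open>(\<Phi> f)(x) = x\<^sub>n f(x\<^sub>n + \<alpha>, x\<^sub>1, \<dots>, x\<^sub>n\<^sub>-\<^sub>1)\<close> determine a linear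
  map \<open>\<Psi>\<close> on polynomials with \<open>\<Psi>(1) = 1\<close>, \<open>\<Psi> s\<^sub>i = \<sigma>\<^sub>i \<Psi>\<close> and \<open>\<Psi>(x\<^sub>n f(x\<^sub>n, x\<^sub>1, \<dots>, x\<^sub>n\<^sub>-\<^sub>1)) = \<Phi> \<Psi>(f)\<close>,
  and \<open>B\<close> is the image under \<open>\<Psi>\<close> of an integral nonsymmetric Jack polynomial. The latter is a
  nonnegative combination of monomials, by the Knop-Sahi recursion: with \<open>m\<close> the last position
  where \<open>\<eta>\<close> is nonzero, \<open>B\<^sub>\<eta>\<close> is a combination of the \<open>\<sigma>\<^sub>k \<cdots> \<sigma>\<^sub>n\<^sub>-\<^sub>1 \<Phi>\<close>, \<open>k \<ge> m\<close>, applied to the \<open>B\<close> of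
  \<open>(\<eta>\<^sub>m - 1, \<eta>\<^sub>1, \<dots>, \<eta>\<^sub>m\<^sub>-\<^sub>1, 0, \<dots>, 0)\<close>.

  It remains to see that \<open>\<Psi>(x\<^sup>\<zeta>)\<close> has coefficients in \<open>\<nat>[\<alpha>]\<close>. Now
  \<open>\<Psi>(x\<^sub>m f) = x\<^sub>m \<Psi>(f) + \<Psi>(\<xi>\<^sub>m f)\<close> with \<open>\<xi>\<^sub>m\<close> a Cherednik operator, and if \<open>m\<close> is the first position
  of the maximum of \<open>\<zeta>\<close>, then \<open>\<xi>\<^sub>m (x\<^sup>\<zeta> / x\<^sub>m)\<close> is a combination of monomials with coefficients in \<open>\<nat>[\<alpha>]\<close>,
  so induction on the degree applies.
\<close>

section \<open>Generic points and Hecke operators\<close>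

text \<open>Multiplying by r turns the relation into \<open>a r + b = 0\<close> between polynomials
  in r. The genericity of the interpolation points and the non-vanishing of hook factors rest on
  this.\<close>

lemma of_int_alpha_independent:
  assumes "of_int a + of_int b * alpha = 0"
  shows "a = 0 \<and> b = 0"
proof -
  have r: "r_indet \<noteq> 0"
    using alpha_nonzero by (auto simp: alpha_def)
  have "of_int a * r_indet + of_int b = (of_int a + of_int b * alpha) * r_indet"
    using r by (simp add: alpha_def field_simps)
  then have "of_int a * r_indet + of_int b = 0"
    using assms by simp
  moreover have "of_int a * r_indet + of_int b = to_fract [:of_int b, of_int a:]"
  proof -
    have nat: "(of_nat k :: Qr) = to_fract (of_nat k)" for k
      by (simp add: of_nat_fract to_fract_def)
    have "(of_int k :: Qr) = to_fract (of_int k)" for k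
      by (cases k rule: int_cases2) (simp_all add: nat to_fract_uminus)
    then show ?thesis
      unfolding r_indet_def by (simp flip: to_fract_mult to_fract_add add: of_int_poly)
  qed
  ultimately show ?thesis by simp
qed

text \<open>
  On these points the denominators in \<open>\<sigma>\<^sub>i\<close> never vanish, and the rescaled interpolation points are among them.
\<close>

typedef point = "{v :: nat \<Rightarrow> Qr. \<forall>i j. i \<noteq> j \<longrightarrow> (\<forall>k::int. v i - v j \<noteq> of_int k * alpha)}"
  morphisms coord Point
proof -
  have "of_nat i - of_nat j \<noteq> of_int k * alpha" if "i \<noteq> j" for i j :: nat and k :: int
    using of_int_alpha_independent[of "int i - int j" "- k"] that by auto
  then show ?thesis by blast
qed

setup_lifting type_definition_point

lemma coord_diff: "i \<noteq> j \<Longrightarrow> coord v i - coord v j \<noteq> of_int k * alpha"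
  using coord by blast

lemma coord_distinct: "i \<noteq> j \<Longrightarrow> coord v i \<noteq> coord v j"
  using coord_diff[of i j v 0] by auto

abbreviation adj :: "nat \<Rightarrow> nat \<Rightarrow> nat" where
  "adj i \<equiv> Transposition.transpose i (Suc i)"

lift_definition swap_pt :: "nat \<Rightarrow> point \<Rightarrow> point" is "\<lambda>i v. v \<circ> adj i"
  by (metis comp_apply transpose_eq_imp_eq)

lemma coord_swap_pt: "coord (swap_pt i v) k = coord v (adj i k)"
  by transfer simp

lemma point_eqI: "(\<And>i. coord v i = coord w i) \<Longrightarrow> v = w"
  by transfer auto

lemma swap_pt_simps:
  "swap_pt i (swap_pt i v) = v"
  "Suc i < j \<Longrightarrow> swap_pt i (swap_pt j v) = swap_pt j (swap_pt i v)"
  "swap_pt i (swap_pt (Suc i) (swap_pt i v)) = swap_pt (Suc i) (swap_pt i (swap_pt (Suc i) v))"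
  by (auto intro!: point_eqI simp: coord_swap_pt transpose_def)

section \<open>The operators \<open>sig\<close> and the relations of the symmetric group\<close>

definition sig :: "nat \<Rightarrow> (point \<Rightarrow> Qr) \<Rightarrow> point \<Rightarrow> Qr" where
  "sig i f v = (1 + 1 / (coord v i - coord v (Suc i))) * f (swap_pt i v)
     - f v / (coord v i - coord v (Suc i))"

text \<open>The difference of the two coordinates changes sign under the swap. With \<open>d\<close>
  its reciprocal, the cross terms \<open>d (1 + d)\<close> cancel and
  \<open>(1 - d^2) + d^2 = 1\<close> remains.\<close>

lemma sig_sig: "sig i (sig i f) = f"
proof
  fix v
  have "(1 + 1 / (a - b)) * ((1 + 1 / (b - a)) * x - y / (b - a)) - ((1 + 1 / (a - b)) * y - x / (a - b)) / (a - b) = x"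
    if "a \<noteq> b" for a b x y :: Qr
  proof -
    define d where "d = 1 / (a - b)"
    have "1 / (b - a) = - d" "y / (b - a) = - d * y" "z / (a - b) = d * z" for z
      using that by (auto simp: d_def field_simps)
    then show ?thesis by (simp add: algebra_simps)
  qed
  then show "sig i (sig i f) v = f v"
    using coord_distinct[of i "Suc i" v] by (simp add: sig_def coord_swap_pt swap_pt_simps)
qed

lemma sig_commute:
  assumes "Suc i < j"
  shows "sig i (sig j f) = sig j (sig i f)"
proof
  fix v
  have "adj i j = j" "adj i (Suc j) = Suc j" "adj j i = i" "adj j (Suc i) = Suc i"
    using assms by (auto simp: transpose_def)
  then show "sig i (sig j f) v = sig j (sig i f) v"
    unfolding sig_def coord_swap_pt swap_pt_simps(2)[OF assms]
    by (simp add: algebra_simps add_divide_distrib diff_divide_distrib)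
qed

text \<open>Written in the reciprocals \<open>d\<close>, \<open>e\<close>, \<open>g\<close> of the
  coordinate differences, the two sides differ by a multiple of
  \<open>d * e - d * g - g * e\<close>, which is zero by partial fractions.\<close>

lemma sig_braid: "sig i (sig (Suc i) (sig i f)) = sig (Suc i) (sig i (sig (Suc i) f))"
proof
  fix v
  define a b c where "a = coord v i" and "b = coord v (Suc i)" and "c = coord v (Suc (Suc i))"
  define d e g where "d = 1 / (a - b)" and "e = 1 / (b - c)" and "g = 1 / (a - c)"
  have ne: "a - b \<noteq> 0" "b - c \<noteq> 0" "a - c \<noteq> 0"
    using coord_distinct by (auto simp: a_def b_def c_def)
  have inv: "x / (a - b) = d * x" "x / (b - a) = - d * x" "x / (b - c) = e * x"
     "x / (c - b) = - e * x" "x / (a - c) = g * x" "x / (c - a) = - g * x" for x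
    using minus_divide_right[of x "a - b"] minus_divide_right[of x "b - c"] minus_divide_right[of x "a - c"]
    by (auto simp: d_def e_def g_def)
  have deg: "d * e = d * g + g * e"
    using ne by (simp add: d_def e_def g_def divide_simps)
  have sw: "adj i i = Suc i" "adj i (Suc i) = i" "adj i (Suc (Suc i)) = Suc (Suc i)"
    "adj (Suc i) (Suc i) = Suc (Suc i)" "adj (Suc i) i = i" "adj (Suc i) (Suc (Suc i)) = Suc i"
    by (auto simp: transpose_def)
  let ?s = "swap_pt i" and ?t = "swap_pt (Suc i)"
  have "sig i (sig (Suc i) (sig i f)) v - sig (Suc i) (sig i (sig (Suc i) f)) v
     = (d * e - d * g - g * e) * ((1 + d) * f (?s v) - (1 + e) * f (?t v)
        + (e - d) * f v)"
    unfolding sig_def coord_swap_pt sw swap_pt_simps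
    unfolding a_def[symmetric] b_def[symmetric] c_def[symmetric]
    unfolding inv
    by (simp add: algebra_simps swap_pt_simps)
  then show "sig i (sig (Suc i) (sig i f)) v = sig (Suc i) (sig i (sig (Suc i) f)) v"
    using deg by simp
qed

section \<open>The rotation with shift by alpha, and its relations with \<open>sig\<close>\<close>

definition cyc :: "nat \<Rightarrow> nat \<Rightarrow> nat" where
  "cyc m i = (if i = 1 then m else if 2 \<le> i \<and> i \<le> m then i - 1 else i)"

lemma cyc_inj: "1 \<le> m \<Longrightarrow> cyc m i = cyc m j \<Longrightarrow> i = j"
  by (auto simp: cyc_def split: if_splits)

lemma bij_betw_cyc:
  assumes "m \<in> {1..n}"
  shows "bij_betw (cyc m) {1..n} {1..n}"
proof -
  have inj: "inj_on (cyc m) {1..n}"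
    using assms cyc_inj[of m] by (auto intro!: inj_onI)
  moreover have "cyc m ` {1..n} \<subseteq> {1..n}"
    using assms by (auto simp: cyc_def)
  ultimately show ?thesis
    by (simp add: bij_betw_def endo_inj_surj)
qed

locale interpolation_dim =
  fixes n :: nat
  assumes n_pos: "1 \<le> n"
begin

definition rot_pt :: "point \<Rightarrow> point" where
  "rot_pt v = Point (\<lambda>i. coord v (cyc n i) + (if i = 1 then alpha else 0))"

text \<open>The added alpha changes coordinate differences by integer multiples of alpha only, so
  the rotated tuple is again generic. This is why points exclude all these multiples and not just
  zero.\<close>

lemma coord_rot_pt: "coord (rot_pt v) i = coord v (cyc n i) + (if i = 1 then alpha else 0)"
proof -
  have "coord v (cyc n i) + (if i = 1 then alpha else 0) - (coord v (cyc n j) + (if j = 1 then alpha else 0)) \<noteq> of_int k * alpha"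
    if "i \<noteq> j" for i j and k :: int
  proof
    assume eq: "coord v (cyc n i) + (if i = 1 then alpha else 0) - (coord v (cyc n j) + (if j = 1 then alpha else 0)) = of_int k * alpha"
    define l where "l = k - (if i = 1 then 1 else 0) + (if j = 1 then 1 else 0)"
    have "coord v (cyc n i) - coord v (cyc n j) = of_int l * alpha"
      using eq by (auto simp: l_def algebra_simps split: if_splits)
    with that show False using cyc_inj[OF n_pos] coord_diff by blast
  qed
  then show ?thesis
    by (simp add: rot_pt_def Point_inverse)
qed

definition Phi :: "(point \<Rightarrow> Qr) \<Rightarrow> point \<Rightarrow> Qr" where
  "Phi f v = coord v n * f (rot_pt v)"

text \<open>The rotation carries coordinates i and i + 1 to the next positions without the shift,
  and the factor \<open>x_n\<close> is fixed by the swap.\<close>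

lemma sig_Phi:
  assumes "1 \<le> i" "Suc i < n"
  shows "sig i (Phi f) = Phi (sig (Suc i) f)"
proof
  fix v
  have "rot_pt (swap_pt i v) = swap_pt (Suc i) (rot_pt v)"
    using assms by (auto intro!: point_eqI simp: coord_swap_pt coord_rot_pt cyc_def transpose_def)
  moreover have "coord (rot_pt v) (Suc i) = coord v i" "coord (rot_pt v) (Suc (Suc i)) = coord v (Suc i)"
    "adj i n = n"
    using assms by (auto simp: coord_rot_pt cyc_def transpose_def)
  ultimately show "sig i (Phi f) v = Phi (sig (Suc i) f) v"
    unfolding sig_def Phi_def coord_swap_pt by (simp add: algebra_simps)
qed

text \<open>After two rotations \<open>x_{n-1}\<close> and \<open>x_n\<close> stand first and both
  carry the shift, so their difference is unchanged; the accumulated factor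
  \<open>x_{n-1} x_n\<close> is symmetric.\<close>

lemma sig_Phi_Phi:
  assumes "2 \<le> n"
  shows "sig (n - 1) (Phi (Phi f)) = Phi (Phi (sig 1 f))"
proof
  fix v
  have "rot_pt (rot_pt (swap_pt (n - 1) v)) = swap_pt 1 (rot_pt (rot_pt v))"
  proof (rule point_eqI)
    fix k
    have c: "cyc n 0 = 0" "cyc n 1 = n" "cyc n 2 = 1" "cyc n n = n - 1" "n \<noteq> 1" "n - 1 \<noteq> 0"
      "adj (n - 1) n = n - 1" "adj (n - 1) (n - 1) = n" "adj 1 1 = 2" "adj 1 2 = 1"
      "adj (n - 1) 0 = 0" "adj 1 0 = 0"
      using assms by (auto simp: cyc_def transpose_def)
    consider "k = 0" | "k = 1" | "k = 2" | "3 \<le> k" "k \<le> n" | "n < k" by linarith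
    then show "coord (rot_pt (rot_pt (swap_pt (n - 1) v))) k = coord (swap_pt 1 (rot_pt (rot_pt v))) k"
    proof cases
      case 4
      have "cyc n (cyc n k) = k - 2" "cyc n k \<noteq> 1" "adj (n - 1) (k - 2) = k - 2" "adj 1 k = k" "k \<noteq> 1"
        using 4 by (auto simp: cyc_def transpose_def)
      then show ?thesis by (simp add: coord_swap_pt coord_rot_pt)
    next
      case 5
      have "cyc n k = k" "adj (n - 1) k = k" "adj 1 k = k" "k \<noteq> 1"
        using 5 assms by (auto simp: cyc_def transpose_def)
      then show ?thesis by (simp add: coord_swap_pt coord_rot_pt)
    qed (simp_all only: c coord_swap_pt coord_rot_pt, simp_all)
  qed
  moreover have "coord (rot_pt (rot_pt v)) 1 = coord v (n - 1) + alpha"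
    "coord (rot_pt (rot_pt v)) (Suc 1) = coord v n + alpha" "Suc (n - 1) = n"
    "coord (rot_pt w) n = coord w (n - 1)" for w
    using assms by (auto simp: coord_rot_pt cyc_def)
  moreover have "adj (n - 1) n = n - 1" "adj (n - 1) (n - 1) = n"
    using assms by (auto simp: transpose_def)
  then have "coord (swap_pt (n - 1) v) (n - 1) = coord v n" "coord (swap_pt (n - 1) v) n = coord v (n - 1)"
    by (simp_all add: coord_swap_pt)
  ultimately show "sig (n - 1) (Phi (Phi f)) v = Phi (Phi (sig 1 f)) v"
    unfolding sig_def Phi_def by (simp add: algebra_simps)
qed

lemma sig_cmult: "sig i (\<lambda>v. c * f v) = (\<lambda>v. c * sig i f v)"
  by (rule ext) (simp add: sig_def algebra_simps)

lemma sig_add: "sig i (\<lambda>v. f v + g v) = (\<lambda>v. sig i f v + sig i g v)"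
  by (rule ext) (simp add: sig_def algebra_simps add_divide_distrib)

lemma sig_diff: "sig i (\<lambda>v. f v - g v) = (\<lambda>v. sig i f v - sig i g v)"
  by (rule ext) (simp add: sig_def algebra_simps diff_divide_distrib)

lemma sig_sum: "sig i (\<lambda>v. \<Sum>a\<in>A. f a v) = (\<lambda>v. \<Sum>a\<in>A. sig i (f a) v)"
proof -
  have "sig i (\<lambda>v. 0) = (\<lambda>v. 0)"
    by (rule ext) (simp add: sig_def)
  then show ?thesis
    by (induction A rule: infinite_finite_induct) (simp_all add: sig_add)
qed

lemma Phi_cmult: "Phi (\<lambda>v. c * f v) = (\<lambda>v. c * Phi f v)"
  by (rule ext) (simp add: Phi_def)

lemma Phi_diff: "Phi (\<lambda>v. f v - g v) = (\<lambda>v. Phi f v - Phi g v)"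
  by (rule ext) (simp add: Phi_def algebra_simps)

lemma Phi_sum: "Phi (\<lambda>v. \<Sum>a\<in>A. f a v) = (\<lambda>v. \<Sum>a\<in>A. Phi (f a) v)"
  by (rule ext) (simp add: Phi_def sum_distrib_left)

primrec sig_chain :: "nat \<Rightarrow> (point \<Rightarrow> Qr) \<Rightarrow> point \<Rightarrow> Qr" where
  "sig_chain 0 f = f"
| "sig_chain (Suc j) f = sig (n - Suc j) (sig_chain j f)"

text \<open>The product \<open>sig k ... sig (n - 1) Phi\<close>. Under \<open>Psi\<close> it will
  correspond to \<open>x^e -> x^(shift k e)\<close>, see \<open>Theta_Psi\<close>.\<close>

definition Theta :: "nat \<Rightarrow> (point \<Rightarrow> Qr) \<Rightarrow> point \<Rightarrow> Qr" where
  "Theta k f = sig_chain (n - k) (Phi f)"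

lemma Theta_n: "Theta n f = Phi f"
  by (simp add: Theta_def)

lemma Theta_rec: "k < n \<Longrightarrow> Theta k f = sig k (Theta (Suc k) f)"
proof -
  assume "k < n"
  then have "n - k = Suc (n - Suc k)" "n - Suc (n - Suc k) = k" by auto
  then show ?thesis by (simp only: Theta_def sig_chain.simps)
qed

lemma Theta_sum: "Theta k (\<lambda>v. \<Sum>a\<in>A. f a v) = (\<lambda>v. \<Sum>a\<in>A. Theta k (f a) v)"
proof -
  have "sig_chain j (\<lambda>v. \<Sum>a\<in>A. f a v) = (\<lambda>v. \<Sum>a\<in>A. sig_chain j (f a) v)" for j and f :: "'a \<Rightarrow> point \<Rightarrow> Qr"
    by (induction j) (simp_all add: sig_sum)
  then show ?thesis by (simp add: Theta_def Phi_sum)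
qed

lemma Theta_cmult: "Theta k (\<lambda>v. c * f v) = (\<lambda>v. c * Theta k f v)"
proof -
  have "sig_chain j (\<lambda>v. c * f v) = (\<lambda>v. c * sig_chain j f v)" for j f
    by (induction j) (simp_all add: sig_cmult)
  then show ?thesis by (simp add: Theta_def Phi_cmult)
qed

lemma sig_Theta_below:
  assumes "k \<le> n" "1 \<le> i" "Suc i < k"
  shows "sig i (Theta k f) = Theta k (sig (Suc i) f)"
  using assms
proof (induction k rule: inc_induct)
  case base
  then show ?case by (simp add: Theta_n sig_Phi)
next
  case (step k)
  then have "sig i (Theta k f) = sig k (sig i (Theta (Suc k) f))"
    using sig_commute[of i k] by (simp add: Theta_rec[of k])
  then show ?case using step by (simp add: Theta_rec[of k])
qed

text \<open>For i = k + 1 the braid relation applies: the inner \<open>sig k\<close> then passes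
  through \<open>Theta (k + 2)\<close> and becomes \<open>sig (k + 1)\<close>. For smaller k,
  \<open>sig i\<close> and \<open>sig k\<close> commute.\<close>

lemma sig_Theta_above:
  assumes "1 \<le> k" "k < i" "i < n"
  shows "sig i (Theta k f) = Theta k (sig i f)"
proof -
  have "k \<le> i - 1" using assms by simp
  then show ?thesis using assms(1)
  proof (induction k rule: inc_induct)
    case base
    then obtain j where i: "i = Suc j" "1 \<le> j" using assms(2) by (cases i) auto
    have "sig i (Theta j f) = sig j (sig i (sig j (Theta (Suc i) f)))"
      using assms(3) i by (simp add: Theta_rec sig_braid)
    also have "sig j (Theta (Suc i) f) = Theta (Suc i) (sig i f)"
      using assms(3) i sig_Theta_below[of "Suc i" j f] by simp
    finally show ?case using assms(3) i by (simp add: Theta_rec)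
  next
    case (step k)
    then have "sig i (Theta k f) = sig k (sig i (Theta (Suc k) f))"
      using assms(3) sig_commute[of k i "Theta (Suc k) f"] by (simp add: Theta_rec[of k])
    with step assms(3) show ?case by (simp add: Theta_rec[of k])
  qed
qed

end

section \<open>The images of monomials\<close>

text \<open>If \<open>e m\<close> is positive, then
  \<open>x^e = x_m f(x_m, x_1, ..., x_{m-1}, x_{m+1}, ...)\<close> with
  \<open>f = x^(unshift m e)\<close>.\<close>

definition unshift :: "nat \<Rightarrow> (nat \<Rightarrow> nat) \<Rightarrow> nat \<Rightarrow> nat" where
  "unshift m e = (\<lambda>i. if i = 1 then e m - 1 else e (cyc m i))"

lemma unshift_adj:
  assumes "1 \<le> m"
  shows "unshift m (e \<circ> adj m) = unshift (Suc m) e"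
    "unshift (Suc m) (e \<circ> adj m) = unshift m e"
proof -
  have "unshift m (e \<circ> adj m) k = unshift (Suc m) e k \<and> unshift (Suc m) (e \<circ> adj m) k = unshift m e k" for k
    using assms by (cases "k = Suc m"; cases "k \<le> m"; cases "k = 1") (auto simp: unshift_def cyc_def transpose_def)
  then show "unshift m (e \<circ> adj m) = unshift (Suc m) e" "unshift (Suc m) (e \<circ> adj m) = unshift m e"
    by auto
qed

lemma unshift_adj_below:
  assumes "1 \<le> i" "Suc i < m"
  shows "unshift m (e \<circ> adj i) = unshift m e \<circ> adj (Suc i)"
proof
  fix k
  consider "k = 1" | "k = Suc i" | "k = Suc (Suc i)" | "k \<noteq> 1" "k \<noteq> Suc i" "k \<noteq> Suc (Suc i)" by blast
  then show "unshift m (e \<circ> adj i) k = (unshift m e \<circ> adj (Suc i)) k"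
    using assms by cases (auto simp: unshift_def cyc_def transpose_def)
qed

lemma unshift_adj_above:
  assumes "1 \<le> m" "m < i"
  shows "unshift m (e \<circ> adj i) = unshift m e \<circ> adj i"
  using assms by (auto simp: fun_eq_iff unshift_def cyc_def transpose_def)

text \<open>The counterpart of \<open>sig_Phi_Phi\<close> on exponents.\<close>

lemma unshift_unshift_adj:
  assumes "2 \<le> n"
  shows "unshift n (unshift n (e \<circ> adj (n - 1))) = unshift n (unshift n e) \<circ> adj 1"
proof
  fix k
  have c: "cyc n 0 = 0" "cyc n 2 = 1" "cyc n n = n - 1" "n \<noteq> 1" "n - 1 \<noteq> 0"
    "adj (n - 1) n = n - 1" "adj (n - 1) (n - 1) = n" "adj 1 1 = 2" "adj 1 2 = 1"
    "adj (n - 1) 0 = 0" "adj 1 0 = 0"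
    using assms by (auto simp: cyc_def transpose_def)
  consider "k = 0" | "k = 1" | "k = 2" | "3 \<le> k" "k \<le> n" | "n < k" by linarith
  then show "unshift n (unshift n (e \<circ> adj (n - 1))) k = (unshift n (unshift n e) \<circ> adj 1) k"
  proof cases
    case 4
    then have "cyc n k \<noteq> 1" "cyc n (cyc n k) = k - 2" "adj 1 k = k" "adj (n - 1) (k - 2) = k - 2" "k \<noteq> 1"
      by (auto simp: cyc_def transpose_def)
    then show ?thesis by (simp add: unshift_def)
  next
    case 5
    then have "cyc n k = k" "adj 1 k = k" "adj (n - 1) k = k" "k \<noteq> 1"
      using assms by (auto simp: cyc_def transpose_def)
    then show ?thesis by (simp add: unshift_def)
  qed (simp_all only: unshift_def comp_apply c, simp_all add: c)
qed

section \<open>The recursion for the images of monomials\<close>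

context interpolation_dim
begin

definition wt :: "(nat \<Rightarrow> nat) \<Rightarrow> nat" where
  "wt e = (\<Sum>i=1..n. e i)"

lemma wt_unshift:
  assumes "m \<in> {1..n}" "0 < e m"
  shows "Suc (wt (unshift m e)) = wt e"
proof -
  have "wt e = (\<Sum>i=1..n. e (cyc m i))"
    unfolding wt_def using sum.reindex_bij_betw[OF bij_betw_cyc[OF assms(1)], of e] by simp
  also have "\<dots> = e m + (\<Sum>i\<in>{1..n} - {1}. e (cyc m i))"
    using n_pos by (subst sum.remove[of _ 1]) (auto simp: cyc_def)
  also have "(\<Sum>i\<in>{1..n} - {1}. e (cyc m i)) = (\<Sum>i\<in>{1..n} - {1}. unshift m e i)"
    by (intro sum.cong) (auto simp: unshift_def)
  also have "e m + \<dots> = Suc (wt (unshift m e))"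
    unfolding wt_def using n_pos assms by (subst (2) sum.remove[of _ 1]) (auto simp: unshift_def)
  finally show ?thesis ..
qed

lemma wt_adj:
  assumes "1 \<le> i" "i < n"
  shows "wt (e \<circ> adj i) = wt e"
proof -
  have "bij_betw (adj i) {1..n} {1..n}"
    using assms by (intro bij_betw_transpose_iff) auto
  then show ?thesis
    unfolding wt_def comp_def by (rule sum.reindex_bij_betw)
qed

lemma le_wt: "i \<in> {1..n} \<Longrightarrow> e i \<le> wt e"
  unfolding wt_def by (rule member_le_sum) auto

lemma wt_pos: "0 < wt e \<Longrightarrow> \<exists>m\<in>{1..n}. 0 < e m"
  by (rule ccontr) (simp add: wt_def)

text \<open>Meant for \<open>d = wt e\<close>, which makes the recursion primitive. Taking the last
  nonzero position is one choice among several that agree by \<open>psi_aux\<close>.\<close>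

primrec psi :: "nat \<Rightarrow> (nat \<Rightarrow> nat) \<Rightarrow> point \<Rightarrow> Qr" where
  "psi 0 e = (\<lambda>v. 1)"
| "psi (Suc d) e = (let m = Max {m \<in> {1..n}. 0 < e m} in Theta m (psi d (unshift m e)))"

text \<open>The two claims need a joint induction: independence of the position in degree d uses
  both claims in lower degrees, and the swap rule in degree d uses independence in degree d.\<close>

lemma psi_aux:
  assumes "wt e = d"
  shows "(\<forall>m\<in>{1..n}. 0 < e m \<longrightarrow> psi d e = Theta m (psi (d - 1) (unshift m e))) \<and>
    (\<forall>i. 1 \<le> i \<and> i < n \<longrightarrow> sig i (psi d e) = psi d (e \<circ> adj i))"
  using assms
proof (induction d arbitrary: e rule: less_induct)
  case (less d)
  show ?case
  proof (cases d)
    case 0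
    then have "e m = 0" if "m \<in> {1..n}" for m
      using le_wt[OF that, of e] less.prems by simp
    moreover have "sig i (\<lambda>v. 1) = (\<lambda>v. 1)" for i
      by (rule ext) (simp add: sig_def)
    ultimately show ?thesis using 0 by auto
  next
    case (Suc d')
    have IH_sig: "sig j (psi c f) = psi c (f \<circ> adj j)"
      if "c < d" "wt f = c" "1 \<le> j" "j < n" for c f j
      using less.IH[of c f] that by blast
    have IH_Theta: "psi c f = Theta m (psi (c - 1) (unshift m f))"
      if "c < d" "wt f = c" "m \<in> {1..n}" "0 < f m" for c f m
      using less.IH[of c f] that by blast
    \<comment> \<open>The candidate for \<open>psi d f\<close> that removes position m; the aim is
      that all m with \<open>0 < f m\<close> give the same.\<close>
    define Q where "Q m f = Theta m (psi d' (unshift m f))" for m f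
    have sig_Q: "sig i (Q m f) = Q (adj i m) (f \<circ> adj i)"
      if "wt f = d" "m \<in> {1..n}" "0 < f m" "1 \<le> i" "i < n" for i m f
    proof -
      have wt': "wt (unshift m f) = d'"
        using wt_unshift[of m f] that Suc by simp
      consider "m = Suc i" | "m = i" | "Suc i < m" | "m < i" using that by linarith
      then show ?thesis
      proof cases
        case 1
        then show ?thesis
          using that by (simp add: Q_def unshift_adj Theta_rec)
      next
        case 2
        then have "sig i (Q m f) = sig i (sig i (Theta (Suc i) (psi d' (unshift i f))))"
          using that by (simp add: Q_def Theta_rec)
        then show ?thesis
          using 2 that by (simp add: Q_def unshift_adj sig_sig)
      next
        case 3
        then have "sig i (Q m f) = Theta m (sig (Suc i) (psi d' (unshift m f)))"
          using that by (simp add: Q_def sig_Theta_below)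
        also have "sig (Suc i) (psi d' (unshift m f)) = psi d' (unshift m f \<circ> adj (Suc i))"
          using wt' that 3 Suc by (intro IH_sig) auto
        finally show ?thesis
          using 3 that by (simp add: Q_def unshift_adj_below)
      next
        case 4
        then have "sig i (Q m f) = Theta m (sig i (psi d' (unshift m f)))"
          using that by (simp add: Q_def sig_Theta_above)
        also have "sig i (psi d' (unshift m f)) = psi d' (unshift m f \<circ> adj i)"
          using wt' that 4 Suc by (intro IH_sig) auto
        finally show ?thesis
          using 4 that by (simp add: Q_def unshift_adj_above)
      qed
    qed
    \<comment> \<open>The only pair of positions that needs a new relation: removing both n and n -
      1 produces \<open>Phi (Phi ...)\<close>, through which \<open>sig (n - 1)\<close> passes as
      \<open>sig 1\<close>.\<close>
    have Q_last: "Q (n - 1) f = Q n f"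
      if f: "wt f = d" "2 \<le> n" "0 < f (n - 1)" "0 < f n" for f
    proof -
      have step: "Q n g = Phi (Phi (psi (d' - 1) (unshift n (unshift n g))))"
        if "wt g = d" "0 < g n" "0 < g (n - 1)" for g
      proof -
        have "wt (unshift n g) = d'"
          using wt_unshift[of n g] that n_pos Suc by simp
        moreover have "unshift n g n = g (n - 1)"
          using \<open>2 \<le> n\<close> by (auto simp: unshift_def cyc_def)
        ultimately have "psi d' (unshift n g) = Theta n (psi (d' - 1) (unshift n (unshift n g)))"
          using that Suc n_pos by (intro IH_Theta) auto
        then show ?thesis by (simp add: Q_def Theta_n)
      qed
      define g where "g = f \<circ> adj (n - 1)"
      have Sn: "Suc (n - 1) = n" using n_pos by simp
      have g: "wt g = d" "0 < g n" "0 < g (n - 1)"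
        using f Sn wt_adj[of "n - 1" f] unfolding g_def by (auto simp: transpose_def)
      have w: "wt (unshift n (unshift n f)) = d' - 1" "1 \<le> d'"
      proof -
        have "Suc (wt (unshift n f)) = d" using wt_unshift[of n f] f n_pos by simp
        moreover have "unshift n f n = f (n - 1)"
          using \<open>2 \<le> n\<close> by (auto simp: unshift_def cyc_def)
        then have "Suc (wt (unshift n (unshift n f))) = wt (unshift n f)"
          using wt_unshift[of n "unshift n f"] f n_pos by simp
        ultimately show "wt (unshift n (unshift n f)) = d' - 1" "1 \<le> d'" using Suc by auto
      qed
      have "sig (n - 1) (Q n g) = Q (n - 1) f"
        using sig_Q[of g n "n - 1"] g f Sn by (simp add: g_def comp_assoc transpose_def)
      then have "Q (n - 1) f = sig (n - 1) (Phi (Phi (psi (d' - 1) (unshift n (unshift n g)))))"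
        using step[OF g] by simp
      also have "\<dots> = Phi (Phi (sig 1 (psi (d' - 1) (unshift n (unshift n f) \<circ> adj 1))))"
        unfolding g_def using f(2) by (simp only: unshift_unshift_adj sig_Phi_Phi)
      also have "\<dots> = Phi (Phi (sig 1 (sig 1 (psi (d' - 1) (unshift n (unshift n f))))))"
        using w Suc f(2) IH_sig[of "d' - 1" "unshift n (unshift n f)" 1] by simp
      also have "\<dots> = Q n f"
        using step[of f] f by (simp add: sig_sig)
      finally show ?thesis .
    qed
    \<comment> \<open>\<open>sig i\<close> is injective, so an equality of candidates for the
      swapped exponent pulls back.\<close>
    have Q_transport: "Q m f = Q m' f"
      if "Q (adj i m) (f \<circ> adj i) = Q (adj i m') (f \<circ> adj i)"
        "wt f = d" "m \<in> {1..n}" "0 < f m" "m' \<in> {1..n}" "0 < f m'" "1 \<le> i" "i < n" for m m' i f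
    proof -
      have "sig i (Q m f) = sig i (Q m' f)"
        using that by (simp add: sig_Q)
      then show ?thesis by (metis sig_sig)
    qed
    \<comment> \<open>Swaps carry position m up to n - 1 while n stays fixed; in \<open>Q_lt\<close>
      they carry the larger position up to n.\<close>
    have Q_eq_n: "Q m f = Q n f"
      if "m \<le> n - 1" "1 \<le> m" "wt f = d" "0 < f m" "0 < f n" for m f
      using that
    proof (induction m arbitrary: f rule: inc_induct)
      case base
      then show ?case using Q_last[of f] by simp
    next
      case (step m)
      have "adj m m = Suc m" "adj m n = n" "adj m (Suc m) = m"
        using step.hyps by (auto simp: transpose_def)
      moreover have "Q (Suc m) (f \<circ> adj m) = Q n (f \<circ> adj m)"
      proof (rule step.IH)
        show "wt (f \<circ> adj m) = d" using step.hyps step.prems wt_adj[of m f] by linarith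
      qed (use step.hyps step.prems calculation in simp_all)
      ultimately show ?case
        using step.hyps step.prems by (intro Q_transport[of m m f n]) simp_all
    qed
    have Q_lt: "Q m f = Q m' f"
      if "m' \<le> n" "m < m'" "1 \<le> m" "wt f = d" "0 < f m" "0 < f m'" for m m' f
      using that
    proof (induction m' arbitrary: f rule: inc_induct)
      case base
      then have "m \<le> n - 1" by simp
      from Q_eq_n[OF this] base show ?case by blast
    next
      case (step m')
      have adj: "adj m' m' = Suc m'" "adj m' m = m" "adj m' (Suc m') = m'"
        using step.hyps step.prems(1) by (auto simp: transpose_def)
      have "Q m (f \<circ> adj m') = Q (Suc m') (f \<circ> adj m')"
      proof (rule step.IH)
        show "wt (f \<circ> adj m') = d" using step.hyps step.prems wt_adj[of m' f] by linarith
      qed (use step.hyps step.prems adj in simp_all)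
      then have eq: "Q (adj m' m) (f \<circ> adj m') = Q (adj m' m') (f \<circ> adj m')"
        by (simp only: adj)
      have "m \<in> {1..n}" "m' \<in> {1..n}" "1 \<le> m'" "m' < n"
        using step.hyps step.prems(1,2) by auto
      with eq step.prems show ?case by (intro Q_transport[of m' m f m'])
    qed
    have Q_eq: "Q m f = Q m' f"
      if "m \<in> {1..n}" "m' \<in> {1..n}" "wt f = d" "0 < f m" "0 < f m'" for m m' f
    proof (cases m m' rule: linorder_cases)
      case less
      with Q_lt[of m' m f] that show ?thesis by simp
    next
      case greater
      with Q_lt[of m m' f] that show ?thesis by simp
    qed simp
    have psi_Q: "psi d f = Q m f" if "wt f = d" "m \<in> {1..n}" "0 < f m" for m f
    proof -
      define l where "l = Max {m \<in> {1..n}. 0 < f m}"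
      have "l \<in> {m \<in> {1..n}. 0 < f m}"
        unfolding l_def using that by (intro Max_in) auto
      moreover have "psi d f = Q l f"
        by (simp add: Suc Q_def l_def Let_def)
      ultimately show ?thesis using Q_eq[of l m f] that by simp
    qed
    have "sig i (psi d e) = psi d (e \<circ> adj i)" if "1 \<le> i" "i < n" for i
    proof -
      have "\<exists>m\<in>{1..n}. 0 < e m"
        using less.prems Suc by (intro wt_pos) simp
      then obtain m where m: "m \<in> {1..n}" "0 < e m" by blast
      then have "adj i m \<in> {1..n}" "0 < (e \<circ> adj i) (adj i m)" "wt (e \<circ> adj i) = d"
        using that less.prems by (auto simp: transpose_def wt_adj)
      then show ?thesis
        using psi_Q[OF less.prems m] psi_Q[of "e \<circ> adj i" "adj i m"] sig_Q[of e m i] that m less.prems by metis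
    qed
    moreover have "\<forall>m\<in>{1..n}. 0 < e m \<longrightarrow> psi d e = Theta m (psi (d - 1) (unshift m e))"
      using psi_Q[OF less.prems] Suc by (simp add: Q_def)
    ultimately show ?thesis by blast
  qed
qed

definition Psi :: "(nat \<Rightarrow> nat) \<Rightarrow> point \<Rightarrow> Qr" where
  "Psi e = psi (wt e) e"

lemma sig_Psi: "1 \<le> i \<Longrightarrow> i < n \<Longrightarrow> sig i (Psi e) = Psi (e \<circ> adj i)"
  using psi_aux[OF refl, of e] by (auto simp: Psi_def wt_adj)

lemma Psi_Theta: "m \<in> {1..n} \<Longrightarrow> 0 < e m \<Longrightarrow> Psi e = Theta m (Psi (unshift m e))"
  using psi_aux[OF refl, of e] by (auto simp: Psi_def simp flip: wt_unshift[of m e])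

lemma Psi_0: "wt e = 0 \<Longrightarrow> Psi e = (\<lambda>v. 1)"
  by (simp add: Psi_def)

end

section \<open>Multiplication by a variable\<close>

text \<open>The inverse of \<open>unshift m\<close>: the exponent of
  \<open>x_m f(x_m, x_1, ..., x_{m-1}, x_{m+1}, ...)\<close> for \<open>f = x^e\<close>.\<close>

definition shift :: "nat \<Rightarrow> (nat \<Rightarrow> nat) \<Rightarrow> nat \<Rightarrow> nat" where
  "shift m e = (\<lambda>i. if i = m then e 1 + 1 else if 1 \<le> i \<and> i < m then e (i + 1) else e i)"

lemma unshift_shift: "1 \<le> m \<Longrightarrow> unshift m (shift m e) = e"
  by (auto simp: fun_eq_iff unshift_def shift_def cyc_def)

lemma shift_unshift: "1 \<le> m \<Longrightarrow> 0 < e m \<Longrightarrow> shift m (unshift m e) = e"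
  by (auto simp: fun_eq_iff unshift_def shift_def cyc_def)

lemma shift_upd:
  assumes "j \<in> {1..m}"
  shows "shift m (e(j := t)) = (shift m e)(cyc m j := (if j = 1 then t + 1 else t))"
  using assms by (auto simp: fun_eq_iff shift_def cyc_def)

lemma upd_adj: "e(m := t) \<circ> adj k = (e \<circ> adj k)(adj k m := t)"
proof
  fix i
  have "adj k i = m \<longleftrightarrow> i = adj k m"
    by (metis transpose_involutory)
  then show "(e(m := t) \<circ> adj k) i = ((e \<circ> adj k)(adj k m := t)) i"
    by (simp only: comp_apply fun_upd_apply)
qed

text \<open>
  The divided difference \<open>(x\<^sup>a y\<^sup>b - x\<^sup>b y\<^sup>a) / (x - y)\<close>, where \<open>U t w\<close> stands for \<open>x\<^sup>t y\<^sup>w\<close>.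
\<close>

definition div_diff :: "(nat \<Rightarrow> nat \<Rightarrow> 'b \<Rightarrow> 'a::ab_group_add) \<Rightarrow> nat \<Rightarrow> nat \<Rightarrow> 'b \<Rightarrow> 'a" where
  "div_diff U a b v = (\<Sum>t=b..<a. U t (a + b - 1 - t) v) - (\<Sum>t=a..<b. U t (a + b - 1 - t) v)"

text \<open>The identity \<open>x^(a+1) y^b - x^b y^(a+1) = x (x^a y^b - x^b y^a) + (x - y) x^b
  y^a\<close>, divided by \<open>x - y\<close>.\<close>

lemma div_diff_Suc:
  "div_diff U (Suc a) b v = div_diff (\<lambda>t. U (Suc t)) a b v + U b a v"
proof (cases "b \<le> a")
  case True
  have "(\<Sum>t=b..<Suc a. U t (a + b - t) v) = U b a v + (\<Sum>t=Suc b..<Suc a. U t (a + b - t) v)"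
    using True by (subst sum.atLeast_Suc_lessThan) auto
  also have "(\<Sum>t=Suc b..<Suc a. U t (a + b - t) v) = (\<Sum>t=b..<a. U (Suc t) (a + b - Suc t) v)"
    by (simp only: sum.shift_bounds_Suc_ivl)
  finally show ?thesis
    using True by (simp add: div_diff_def)
next
  case False
  then have "(\<Sum>t=Suc a..<Suc b. U t (a + b - t) v) = (\<Sum>t=Suc a..<b. U t (a + b - t) v) + U b a v"
    by (subst sum.atLeastLessThan_Suc) auto
  moreover have "(\<Sum>t=Suc a..<Suc b. U t (a + b - t) v) = (\<Sum>t=a..<b. U (Suc t) (a + b - Suc t) v)"
    by (simp only: sum.shift_bounds_Suc_ivl)
  ultimately show ?thesis
    using False by (simp add: div_diff_def algebra_simps)
qed

lemma div_diff_Suc_Suc: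
  "div_diff U (Suc a) (Suc b) v = div_diff (\<lambda>t w. U (Suc t) (Suc w)) a b v"
proof -
  have "(\<Sum>t=Suc b..<Suc a. U t (Suc a + Suc b - 1 - t) v) = (\<Sum>t=b..<a. U (Suc t) (Suc (a + b - 1 - t)) v)"
    for a b
    unfolding sum.shift_bounds_Suc_ivl by (intro sum.cong) (auto simp: Suc_diff_Suc)
  from this[of b a] this[of a b] show ?thesis
    by (simp only: div_diff_def add.commute[of "Suc b"] add.commute[of b])
qed

context interpolation_dim
begin

lemma Theta_Psi: "m \<in> {1..n} \<Longrightarrow> Theta m (Psi e) = Psi (shift m e)"
  by (subst Psi_Theta[of m "shift m e"]) (auto simp: unshift_shift, simp add: shift_def)

lemma Phi_Psi: "Phi (Psi e) = Psi (shift n e)"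
  using Theta_Psi[of n e] n_pos by (simp add: Theta_n)

text \<open>The cross relation of the graded Hecke algebra. The correction is
  \<open>(x_{s(m)} - x_m) / (x_i - x_{i+1})\<close> times f, where s swaps i and i + 1.\<close>

lemma sig_coord:
  "sig i (\<lambda>v. coord v m * f v) = (\<lambda>v. coord v (adj i m) * sig i f v
     + (if m = Suc i then f v else if m = i then - f v else 0))"
proof
  fix v
  define q where "q = 1 / (coord v i - coord v (Suc i))"
  have q: "q * (coord v i - coord v (Suc i)) = 1" "x / (coord v i - coord v (Suc i)) = q * x" for x
    using coord_distinct[of i "Suc i" v] by (simp_all add: q_def)
  have q': "q * (x * coord v i) = x + q * (x * coord v (Suc i))" for x
  proof -
    have "q * (x * coord v i) - q * (x * coord v (Suc i)) = q * (coord v i - coord v (Suc i)) * x"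
      by (simp add: algebra_simps)
    then show ?thesis unfolding q(1) by (simp only: mult_1_left diff_eq_eq)
  qed
  consider "m = i" | "m = Suc i" | "m \<noteq> i" "m \<noteq> Suc i" by blast
  then show "sig i (\<lambda>v. coord v m * f v) v = coord v (adj i m) * sig i f v
     + (if m = Suc i then f v else if m = i then - f v else 0)"
    by cases (simp_all add: sig_def coord_swap_pt q(2) algebra_simps q')
qed

lemma Phi_coord:
  "Phi (\<lambda>v. coord v m * f v) = (\<lambda>v. (coord v (cyc n m) + (if m = 1 then alpha else 0)) * Phi f v)"
  by (rule ext) (simp add: Phi_def coord_rot_pt)

lemma sig_div_diff: "sig i (div_diff U a b) = div_diff (\<lambda>t w. sig i (U t w)) a b"
  unfolding div_diff_def[abs_def] by (simp add: sig_diff sig_sum)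

lemma Phi_div_diff: "Phi (div_diff U a b) = div_diff (\<lambda>t w. Phi (U t w)) a b"
  unfolding div_diff_def[abs_def] by (simp add: Phi_diff Phi_sum)

text \<open>
  The summand of \<open>\<xi>\<^sub>m\<close> belonging to \<open>j\<close> is \<open>(x\<^sub>m - x\<^sub>j s) / (x\<^sub>m - x\<^sub>j)\<close> for \<open>m < j\<close> and \<open>x\<^sub>m (1 - s) / (x\<^sub>m - x\<^sub>j)\<close>
  for \<open>j < m\<close>, where \<open>s\<close> exchanges \<open>x\<^sub>m\<close> and \<open>x\<^sub>j\<close>.
\<close>

definition cherednik_term :: "nat \<Rightarrow> nat \<Rightarrow> (nat \<Rightarrow> nat) \<Rightarrow> point \<Rightarrow> Qr" where
  "cherednik_term m j e =
     (if m < j then div_diff (\<lambda>t w. Psi (e(m := t, j := w))) (Suc (e m)) (e j)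
      else div_diff (\<lambda>t w. Psi (e(m := Suc t, j := w))) (e m) (e j))"

text \<open>This is \<open>x_m Psi(g) = Psi(x_m g - xi_m g)\<close> for \<open>g = x^e\<close>,
  where \<open>xi_m\<close> is alpha times the Euler operator \<open>x_m d/dx_m\<close> plus the sum
  over j of the operators in \<open>cherednik_term\<close>.\<close>

definition mult_rule :: "(nat \<Rightarrow> nat) \<Rightarrow> nat \<Rightarrow> bool" where
  "mult_rule e m \<longleftrightarrow> (\<lambda>v. coord v m * Psi e v) =
     (\<lambda>v. Psi (e(m := Suc (e m))) v - alpha * of_nat (e m) * Psi e v
        - (\<Sum>j\<in>{1..n} - {m}. cherednik_term m j e v))"

text \<open>The swap reverses the order of m and j only if they are k and k + 1. The two shapes of
  the term then differ, by \<open>div_diff_Suc\<close>, by \<open>Psi e\<close> alone; this matches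
  the correction in \<open>sig_coord\<close>.\<close>

lemma sig_cherednik_term:
  assumes "1 \<le> k" "k < n" "m \<noteq> j"
  shows "sig k (cherednik_term m j e) v = cherednik_term (adj k m) (adj k j) (e \<circ> adj k) v
    - (if j = adj k m then (if m = Suc k then Psi e v else if m = k then - Psi e v else 0) else 0)"
proof -
  have upd: "sig k (Psi (e(m := t, j := w))) = Psi ((e \<circ> adj k)(adj k m := t, adj k j := w))" for t w
    using assms by (simp add: sig_Psi upd_adj)
  have neq: "j \<noteq> adj k m" if "\<not> (m = k \<and> j = Suc k)" "\<not> (m = Suc k \<and> j = k)"
    using that \<open>m \<noteq> j\<close> by (auto simp: transpose_def)
  have less: "m < j \<longleftrightarrow> adj k m < adj k j" if "\<not> (m = k \<and> j = Suc k)" "\<not> (m = Suc k \<and> j = k)"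
    using that \<open>m \<noteq> j\<close> by (cases "m = k"; cases "m = Suc k"; cases "j = k"; cases "j = Suc k") auto
  consider "m = k" "j = Suc k" | "m = Suc k" "j = k" | "j \<noteq> adj k m" "m < j \<longleftrightarrow> adj k m < adj k j"
    using less neq by blast
  then show ?thesis
  proof cases
    case 1
    then have "sig k (cherednik_term m j e) v
       = div_diff (\<lambda>t w. Psi ((e \<circ> adj k)(Suc k := t, k := w))) (Suc (e k)) (e (Suc k)) v"
      using upd by (simp add: cherednik_term_def sig_div_diff comp_def)
    also have "\<dots> = cherednik_term (Suc k) k (e \<circ> adj k) v
       + Psi ((e \<circ> adj k)(Suc k := e (Suc k), k := e k)) v"
      by (simp add: div_diff_Suc cherednik_term_def comp_def)
    also have "(e \<circ> adj k)(Suc k := e (Suc k), k := e k) = e"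
      by (auto simp: fun_eq_iff transpose_def)
    finally show ?thesis using 1 by (simp add: comp_def)
  next
    case 2
    then have "sig k (cherednik_term m j e) v
       = div_diff (\<lambda>t w. Psi ((e \<circ> adj k)(k := Suc t, Suc k := w))) (e (Suc k)) (e k) v"
      using upd by (simp add: cherednik_term_def sig_div_diff comp_def)
    also have "\<dots> = cherednik_term k (Suc k) (e \<circ> adj k) v
       - Psi ((e \<circ> adj k)(k := e k, Suc k := e (Suc k))) v"
      by (simp add: div_diff_Suc cherednik_term_def comp_def)
    also have "(e \<circ> adj k)(k := e k, Suc k := e (Suc k)) = e"
      by (auto simp: fun_eq_iff transpose_def)
    finally show ?thesis using 2 by (simp add: comp_def)
  next
    case 3
    then show ?thesis
      using upd by (simp add: cherednik_term_def sig_div_diff comp_def)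
  qed
qed

text \<open>Apply \<open>sig k\<close> to the rule for e. The corrections from
  \<open>sig_coord\<close> and from \<open>sig_cherednik_term\<close> cancel.\<close>

lemma mult_rule_adj:
  assumes "mult_rule e m" "1 \<le> k" "k < n" "m \<in> {1..n}"
  shows "mult_rule (e \<circ> adj k) (adj k m)"
  unfolding mult_rule_def
proof
  fix v
  define d where "d = (if m = Suc k then Psi e v else if m = k then - Psi e v else 0)"
  have bij: "bij_betw (adj k) ({1..n} - {m}) ({1..n} - {adj k m})"
  proof -
    have "adj k ` {1..n} = {1..n}" using assms by (intro transpose_image_eq) auto
    then have "adj k ` ({1..n} - {m}) = {1..n} - {adj k m}"
      by (simp add: image_set_diff inj_transpose)
    then show ?thesis by (simp add: bij_betw_def)
  qed
  have "(\<Sum>j\<in>{1..n} - {m}. sig k (cherednik_term m j e) v)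
      = (\<Sum>j\<in>{1..n} - {m}. cherednik_term (adj k m) (adj k j) (e \<circ> adj k) v - (if j = adj k m then d else 0))"
    using assms by (intro sum.cong refl) (subst sig_cherednik_term, auto simp: d_def)
  also have "\<dots> = (\<Sum>j\<in>{1..n} - {m}. cherednik_term (adj k m) (adj k j) (e \<circ> adj k) v)
      - (if adj k m \<in> {1..n} - {m} then d else 0)"
    by (simp add: sum_subtractf)
  also have "(if adj k m \<in> {1..n} - {m} then d else 0) = d"
    using assms by (auto simp: d_def transpose_def)
  also have "(\<Sum>j\<in>{1..n} - {m}. cherednik_term (adj k m) (adj k j) (e \<circ> adj k) v)
      = (\<Sum>j\<in>{1..n} - {adj k m}. cherednik_term (adj k m) j (e \<circ> adj k) v)"
    using bij by (rule sum.reindex_bij_betw)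
  finally have D: "(\<Sum>j\<in>{1..n} - {m}. sig k (cherednik_term m j e) v)
      = (\<Sum>j\<in>{1..n} - {adj k m}. cherednik_term (adj k m) j (e \<circ> adj k) v) - d" .
  have "sig k (\<lambda>v. coord v m * Psi e v) = sig k (\<lambda>v. Psi (e(m := Suc (e m))) v
      - alpha * of_nat (e m) * Psi e v - (\<Sum>j\<in>{1..n} - {m}. cherednik_term m j e v))"
    using assms(1) by (simp add: mult_rule_def)
  from fun_cong[OF this, of v]
  have "coord v (adj k m) * Psi (e \<circ> adj k) v + d
     = Psi ((e \<circ> adj k)(adj k m := Suc (e m))) v - alpha * of_nat (e m) * Psi (e \<circ> adj k) v
       - (\<Sum>j\<in>{1..n} - {m}. sig k (cherednik_term m j e) v)"
    using assms by (simp add: sig_coord sig_diff sig_cmult sig_sum sig_Psi upd_adj d_def)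
  then show "coord v (adj k m) * Psi (e \<circ> adj k) v =
     Psi ((e \<circ> adj k)(adj k m := Suc ((e \<circ> adj k) (adj k m)))) v
     - alpha * of_nat ((e \<circ> adj k) (adj k m)) * Psi (e \<circ> adj k) v
     - (\<Sum>j\<in>{1..n} - {adj k m}. cherednik_term (adj k m) j (e \<circ> adj k) v)"
    unfolding D by (simp add: algebra_simps)
qed

text \<open>Position 1 goes to n and its exponent rises by one. For m = 1 the shape for m < j
  thereby becomes the one for j < m; for j = 1 the converse happens, where
  \<open>div_diff_Suc_Suc\<close> takes out a common factor.\<close>

lemma Phi_cherednik_term:
  assumes "m \<in> {1..n}" "j \<in> {1..n}" "m \<noteq> j"
  shows "Phi (cherednik_term m j e) v = cherednik_term (cyc n m) (cyc n j) (shift n e) v"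
proof -
  have upd: "Phi (Psi (e(m := t, j := w))) = Psi ((shift n e)
      (cyc n m := (if m = 1 then Suc t else t), cyc n j := (if j = 1 then Suc w else w)))" for t w
    using assms by (simp add: Phi_Psi shift_upd)
  have sh: "shift n e (cyc n i) = e i" if "i \<in> {1..n}" "i \<noteq> 1" for i
    using that by (auto simp: cyc_def shift_def)
  have less: "m < j \<longleftrightarrow> cyc n m < cyc n j" if "m \<noteq> 1" "j \<noteq> 1"
    using assms that by (auto simp: cyc_def)
  consider "m = 1" | "j = 1" | "m \<noteq> 1" "j \<noteq> 1" "m < j \<longleftrightarrow> cyc n m < cyc n j"
    using less by blast
  then show ?thesis
  proof cases
    case 1
    then have "m < j" "cyc n m = n" "\<not> n < cyc n j" "shift n e (cyc n j) = e j" "shift n e n = Suc (e m)" "j \<noteq> 1"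
      using assms by (auto simp: cyc_def shift_def)
    then show ?thesis
      using 1 upd by (simp add: cherednik_term_def Phi_div_diff)
  next
    case 2
    then have "\<not> m < j" "cyc n j = n" "cyc n m < n" "shift n e (cyc n m) = e m" "shift n e n = Suc (e j)" "m \<noteq> 1"
      using assms by (auto simp: cyc_def shift_def)
    then show ?thesis
      using 2 upd by (simp add: cherednik_term_def Phi_div_diff div_diff_Suc_Suc)
  next
    case 3
    then show ?thesis
      using upd sh assms by (simp add: cherednik_term_def Phi_div_diff)
  qed
qed

text \<open>Apply \<open>Phi\<close> to the rule for e. For m = 1 the extra alpha in
  \<open>Phi_coord\<close> accounts for the exponent that has risen by one.\<close>

lemma mult_rule_shift:
  assumes "mult_rule e m" "m \<in> {1..n}"
  shows "mult_rule (shift n e) (cyc n m)"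
  unfolding mult_rule_def
proof
  fix v
  have bij: "bij_betw (cyc n) ({1..n} - {m}) ({1..n} - {cyc n m})"
  proof -
    have inj: "inj_on (cyc n) {1..n}" and img: "cyc n ` {1..n} = {1..n}"
      using bij_betw_cyc[of n n] n_pos by (auto simp: bij_betw_def)
    have "cyc n ` ({1..n} - {m}) = {1..n} - {cyc n m}"
      using inj_on_image_set_diff[OF inj, of "{1..n}" "{m}"] assms(2) img by simp
    then show ?thesis
      using inj by (auto simp: bij_betw_def intro: inj_on_subset)
  qed
  have D: "(\<Sum>j\<in>{1..n} - {m}. Phi (cherednik_term m j e) v)
      = (\<Sum>j\<in>{1..n} - {cyc n m}. cherednik_term (cyc n m) j (shift n e) v)"
    unfolding sum.reindex_bij_betw[OF bij, symmetric]
    using assms by (intro sum.cong) (auto simp: Phi_cherednik_term)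
  have "Phi (\<lambda>v. coord v m * Psi e v) = Phi (\<lambda>v. Psi (e(m := Suc (e m))) v
      - alpha * of_nat (e m) * Psi e v - (\<Sum>j\<in>{1..n} - {m}. cherednik_term m j e v))"
    using assms(1) by (simp add: mult_rule_def)
  from fun_cong[OF this, of v]
  have "(coord v (cyc n m) + (if m = 1 then alpha else 0)) * Psi (shift n e) v
     = Psi ((shift n e)(cyc n m := (if m = 1 then Suc (Suc (e m)) else Suc (e m)))) v
       - alpha * of_nat (e m) * Psi (shift n e) v
       - (\<Sum>j\<in>{1..n} - {cyc n m}. cherednik_term (cyc n m) j (shift n e) v)"
    unfolding D[symmetric]
    using assms by (simp add: Phi_coord Phi_diff Phi_cmult Phi_sum Phi_Psi shift_upd)
  moreover have "shift n e (cyc n m) = (if m = 1 then Suc (e m) else e m)"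
    using assms by (auto simp: shift_def cyc_def)
  ultimately show "coord v (cyc n m) * Psi (shift n e) v =
     Psi ((shift n e)(cyc n m := Suc (shift n e (cyc n m)))) v
     - alpha * of_nat (shift n e (cyc n m)) * Psi (shift n e) v
     - (\<Sum>j\<in>{1..n} - {cyc n m}. cherednik_term (cyc n m) j (shift n e) v)"
    by (auto simp: algebra_simps)
qed

text \<open>For m = n all Cherednik terms are empty sums and the rule reads
  \<open>Psi(x_n) = x_n\<close>; swaps carry it down to smaller m.\<close>

lemma mult_rule_zero:
  assumes "m \<le> n" "1 \<le> m" "wt e = 0"
  shows "mult_rule e m"
  using assms
proof (induction m arbitrary: e rule: inc_induct)
  case base
  have e0: "e i = 0" if "i \<in> {1..n}" for i
    using le_wt[OF that, of e] base by simp
  have "Psi (e(n := 1)) = Phi (Psi (unshift n (e(n := 1))))"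
    using Psi_Theta[of n "e(n := 1)"] n_pos by (simp add: Theta_n)
  moreover have "unshift n (e(n := 1)) i = 0" if "i \<in> {1..n}" for i
  proof (cases "i = 1")
    case False
    then have "i - 1 \<in> {1..n}" using that by auto
    from e0[OF this] show ?thesis
      using False that by (auto simp: unshift_def cyc_def)
  qed (simp add: unshift_def)
  then have "wt (unshift n (e(n := 1))) = 0"
    by (simp add: wt_def)
  ultimately have "Psi (e(n := 1)) = (\<lambda>v. coord v n)"
    by (simp add: Psi_0 Phi_def fun_eq_iff)
  moreover have "cherednik_term n j e v = 0" if "j \<in> {1..n} - {n}" for j v
    using that e0[of j] e0[of n] n_pos by (simp add: cherednik_term_def div_diff_def)
  ultimately show ?case
    using base e0[of n] n_pos by (simp add: mult_rule_def Psi_0)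
next
  case (step m)
  have "wt (e \<circ> adj m) = 0"
    using step.hyps step.prems wt_adj[of m e] by simp
  then have "mult_rule (e \<circ> adj m) (Suc m)"
    by (intro step.IH) simp
  then have "mult_rule (e \<circ> adj m \<circ> adj m) (adj m (Suc m))"
    using step by (intro mult_rule_adj) auto
  then show ?case by (simp add: comp_assoc)
qed

text \<open>Swaps bring a nonzero entry to position n; then e is \<open>shift n\<close> of an
  exponent of smaller degree.\<close>

theorem mult_rule: "m \<in> {1..n} \<Longrightarrow> mult_rule e m"
proof (induction "wt e" arbitrary: e m)
  case 0
  then show ?case using mult_rule_zero by simp
next
  case (Suc d)
  have "\<exists>k\<in>{1..n}. 0 < e k"
    using Suc.hyps(2) by (intro wt_pos) simp
  then obtain k where "k \<le> n" "1 \<le> k" "0 < e k" by auto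
  then show ?case using Suc.hyps(2) Suc.prems
  proof (induction k arbitrary: e m rule: inc_induct)
    case base
    have "m \<in> cyc n ` {1..n}"
      using bij_betw_imp_surj_on[OF bij_betw_cyc[of n n]] n_pos base.prems(4) by simp
    then obtain m' where m': "m' \<in> {1..n}" "cyc n m' = m"
      by blast
    have "wt (unshift n e) = d"
      using wt_unshift[of n e] n_pos base.prems by simp
    then have "mult_rule (unshift n e) m'"
      using Suc.hyps(1) m' by blast
    then show ?case
      using mult_rule_shift[of "unshift n e" m'] m' base.prems n_pos by (simp add: shift_unshift)
  next
    case (step k)
    have m: "adj k m \<in> {1..n}"
      using step.hyps step.prems(1,4) by (auto simp: transpose_def)
    have "Suc d = wt (e \<circ> adj k)"
      using step.hyps step.prems(1,3) wt_adj[of k e] by simp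
    then have "mult_rule (e \<circ> adj k) (adj k m)"
      using step.prems(2) m by (intro step.IH) (simp_all add: comp_def)
    then show ?case
      using mult_rule_adj[of "e \<circ> adj k" "adj k m" k] m step.hyps step.prems(1) by (simp add: comp_assoc)
  qed
qed

end

section \<open>Positivity of the images of monomials\<close>

definition nonneg_alpha :: "Qr set" where
  "nonneg_alpha = range (\<lambda>p :: nat poly. poly (map_poly of_nat p) alpha)"

lemma nonneg_alpha_0: "0 \<in> nonneg_alpha"
  unfolding nonneg_alpha_def by (rule range_eqI[of _ _ 0]) simp

lemma nonneg_alpha_of_nat: "of_nat k \<in> nonneg_alpha"
  unfolding nonneg_alpha_def by (rule range_eqI[of _ _ "[:k:]"]) (simp add: map_poly_pCons)

lemma nonneg_alpha_1: "1 \<in> nonneg_alpha"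
  using nonneg_alpha_of_nat[of 1] by simp

lemma nonneg_alpha_alpha: "alpha \<in> nonneg_alpha"
  unfolding nonneg_alpha_def by (rule range_eqI[of _ _ "[:0, 1:]"]) (simp add: map_poly_pCons)

lemma nonneg_alpha_add:
  assumes "a \<in> nonneg_alpha" "b \<in> nonneg_alpha"
  shows "a + b \<in> nonneg_alpha"
proof -
  obtain p q :: "nat poly" where a: "a = poly (map_poly of_nat p) alpha" and b: "b = poly (map_poly of_nat q) alpha"
    using assms by (auto simp: nonneg_alpha_def)
  have "map_poly (of_nat :: nat \<Rightarrow> Qr) (p + q) = map_poly of_nat p + map_poly of_nat q"
    by (rule poly_eqI) (simp add: coeff_map_poly)
  then show ?thesis
    unfolding nonneg_alpha_def a b by (intro range_eqI[of _ _ "p + q"]) simp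
qed

lemma nonneg_alpha_mult:
  assumes "a \<in> nonneg_alpha" "b \<in> nonneg_alpha"
  shows "a * b \<in> nonneg_alpha"
proof -
  obtain p q :: "nat poly" where a: "a = poly (map_poly of_nat p) alpha" and b: "b = poly (map_poly of_nat q) alpha"
    using assms by (auto simp: nonneg_alpha_def)
  have "map_poly (of_nat :: nat \<Rightarrow> Qr) (p * q) = map_poly of_nat p * map_poly of_nat q"
    by (rule poly_eqI) (simp add: coeff_map_poly coeff_mult)
  then show ?thesis
    unfolding nonneg_alpha_def a b by (intro range_eqI[of _ _ "p * q"]) simp
qed

lemma nonneg_alpha_sum: "(\<And>x. x \<in> A \<Longrightarrow> f x \<in> nonneg_alpha) \<Longrightarrow> sum f A \<in> nonneg_alpha"
  by (induction A rule: infinite_finite_induct) (auto intro: nonneg_alpha_0 nonneg_alpha_add)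

section \<open>Combinations of monomials with coefficients in this semiring\<close>

context interpolation_dim
begin

definition monomial :: "(nat \<Rightarrow> nat) \<Rightarrow> point \<Rightarrow> Qr" where
  "monomial e v = (\<Prod>i=1..n. coord v i ^ e i)"

text \<open>The inductive form allows \<open>pos_below_poly\<close> to rebuild an actual polynomial
  term by term. The bound d on the degree is strict, so that \<open>pos_below (wt e)\<close> can
  express what is left of \<open>Psi e\<close> below its top monomial.\<close>

inductive_set pos_below :: "nat \<Rightarrow> (point \<Rightarrow> Qr) set" for d where
  zero: "(\<lambda>v. 0) \<in> pos_below d"
| add_monomial: "c \<in> nonneg_alpha \<Longrightarrow> wt e < d \<Longrightarrow> f \<in> pos_below d \<Longrightarrow> (\<lambda>v. c * monomial e v + f v) \<in> pos_below d"

lemma pos_below_add: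
  assumes "f \<in> pos_below d" "g \<in> pos_below d"
  shows "(\<lambda>v. f v + g v) \<in> pos_below d"
  using assms(1)
proof induction
  case zero
  then show ?case using assms(2) by simp
next
  case (add_monomial c e f)
  then show ?case
    using pos_below.add_monomial[of c e d "\<lambda>v. f v + g v"] by (simp add: add.assoc)
qed

lemma pos_below_cmult:
  assumes "f \<in> pos_below d" "a \<in> nonneg_alpha"
  shows "(\<lambda>v. a * f v) \<in> pos_below d"
  using assms(1)
proof induction
  case zero
  then show ?case using pos_below.zero by simp
next
  case (add_monomial c e f)
  then show ?case
    using pos_below.add_monomial[of "a * c" e d "\<lambda>v. a * f v"] assms(2)
    by (simp add: algebra_simps nonneg_alpha_mult)
qed

lemma pos_below_sum:
  "(\<And>x. x \<in> A \<Longrightarrow> f x \<in> pos_below d) \<Longrightarrow> (\<lambda>v. \<Sum>x\<in>A. f x v) \<in> pos_below d"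
  by (induction A rule: infinite_finite_induct) (auto intro: pos_below.zero pos_below_add)

lemma pos_below_monomial: "wt e < d \<Longrightarrow> monomial e \<in> pos_below d"
  using pos_below.add_monomial[OF nonneg_alpha_1 _ pos_below.zero, of e d] by simp

lemma pos_below_mono_le: "f \<in> pos_below c \<Longrightarrow> c \<le> d \<Longrightarrow> f \<in> pos_below d"
  by (induction rule: pos_below.induct) (auto intro: pos_below.intros)

lemma wt_upd: "m \<in> {1..n} \<Longrightarrow> wt (e(m := t)) + e m = wt e + t"
  unfolding wt_def by (subst (1 2) sum.remove[of _ m]) auto

lemma monomial_upd:
  assumes "m \<in> {1..n}"
  shows "coord v m * monomial e v = monomial (e(m := Suc (e m))) v"
proof -
  have "monomial e' v = coord v m ^ e' m * (\<Prod>i\<in>{1..n} - {m}. coord v i ^ e' i)" for e'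
    unfolding monomial_def using assms by (intro prod.remove) auto
  then show ?thesis by simp
qed

lemma pos_below_coord:
  assumes "f \<in> pos_below d" "m \<in> {1..n}"
  shows "(\<lambda>v. coord v m * f v) \<in> pos_below (Suc d)"
  using assms(1)
proof induction
  case zero
  then show ?case using pos_below.zero by simp
next
  case (add_monomial c e f)
  have "wt (e(m := Suc (e m))) < Suc d"
    using wt_upd[OF assms(2), of e "Suc (e m)"] add_monomial(2) by simp
  then have "(\<lambda>v. c * monomial (e(m := Suc (e m))) v + coord v m * f v) \<in> pos_below (Suc d)"
    using add_monomial by (intro pos_below.add_monomial)
  moreover have "coord v m * (c * monomial e v + f v) = c * monomial (e(m := Suc (e m))) v + coord v m * f v" for v
    using monomial_upd[OF assms(2), of v e] by (simp add: algebra_simps)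
  ultimately show ?case by simp
qed

lemma wt_upd2:
  assumes "m \<in> {1..n}" "j \<in> {1..n}" "m \<noteq> j"
  shows "wt (e(m := t, j := w)) + e m + e j = wt e + t + w"
  using wt_upd[OF assms(1), of e t] wt_upd[OF assms(2), of "e(m := t)" w] assms(3) by simp

text \<open>
  The multiplication rule is used at the first position \<open>m\<close> of the maximum of \<open>e\<close>: then every
  divided difference in the Cherednik operator applied to \<open>x\<^sup>e / x\<^sub>m\<close> has nonnegative coefficients.
\<close>

theorem Psi_positive: "(\<lambda>v. Psi e v - monomial e v) \<in> pos_below (wt e)"
proof (induction "wt e" arbitrary: e rule: less_induct)
  case less
  have IH: "Psi f \<in> pos_below (wt e)" if "wt f < wt e" for f
  proof -
    have "(\<lambda>v. Psi f v - monomial f v) \<in> pos_below (wt e)"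
      using pos_below_mono_le[OF less[OF that]] that by simp
    from pos_below_add[OF this pos_below_monomial[OF that]] show ?thesis by simp
  qed
  show ?case
  proof (cases "wt e = 0")
    case True
    then have "e i = 0" if "i \<in> {1..n}" for i
      using le_wt[OF that, of e] by simp
    then have "monomial e v = 1" for v
      by (simp add: monomial_def)
    then show ?thesis
      using True by (simp add: Psi_0 pos_below.zero)
  next
    case False
    define M where "M = Max (e ` {1..n})"
    define m where "m = (LEAST i. i \<in> {1..n} \<and> e i = M)"
    have "M \<in> e ` {1..n}"
      unfolding M_def using n_pos by (intro Max_in) auto
    then have "\<exists>i. i \<in> {1..n} \<and> e i = M" by auto
    then have "m \<in> {1..n} \<and> e m = M"
      unfolding m_def by (rule LeastI_ex)
    then have m: "m \<in> {1..n}" "e m = M" by auto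
    have le: "e i \<le> e m" if "i \<in> {1..n}" for i
      unfolding m(2) M_def using that by (intro Max_ge) auto
    have lt: "e i < e m" if "i \<in> {1..n}" "i < m" for i
    proof -
      have "e i \<noteq> M"
        using not_less_Least[of i "\<lambda>i. i \<in> {1..n} \<and> e i = M"] that by (auto simp: m_def)
      then show ?thesis using le[OF that(1)] m(2) by simp
    qed
    obtain k where "k \<in> {1..n}" "0 < e k"
      using wt_pos[of e] False by auto
    then have pos: "0 < e m" using le[of k] by simp
    define f where "f = e(m := e m - 1)"
    have f: "f m = e m - 1" "f(m := Suc (f m)) = e" "Suc (wt f) = wt e" "f i = (if i = m then e m - 1 else e i)" for i
      using pos wt_upd[OF m(1), of e "e m - 1"] by (auto simp: f_def)
    have "mult_rule f m" using m(1) by (rule mult_rule)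
    then have rule: "coord v m * Psi f v = Psi e v - alpha * of_nat (f m) * Psi f v
        - (\<Sum>j\<in>{1..n} - {m}. cherednik_term m j f v)" for v
      unfolding mult_rule_def f(2) by meson
    have "coord v m * monomial f v = monomial e v" for v
      using monomial_upd[OF m(1), of v f] f(2) by simp
    \<comment> \<open>The rule for \<open>f\<close>, solved for \<open>Psi e\<close>. Every summand
      on the right involves \<open>Psi\<close> in lower degree only.\<close>
    then have eq: "Psi e v - monomial e v = coord v m * (Psi f v - monomial f v) + alpha * of_nat (f m) * Psi f v
        + (\<Sum>j\<in>{1..n} - {m}. cherednik_term m j f v)" for v
      using rule[of v] by (simp add: algebra_simps)
    have "(\<lambda>v. coord v m * (Psi f v - monomial f v)) \<in> pos_below (wt e)"
      using pos_below_coord[OF less[of f] m(1)] f(3) by simp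
    moreover have "(\<lambda>v. (alpha * of_nat (f m)) * Psi f v) \<in> pos_below (wt e)"
      using f(3) by (intro pos_below_cmult IH nonneg_alpha_mult nonneg_alpha_alpha nonneg_alpha_of_nat) auto
    moreover have "cherednik_term m j f \<in> pos_below (wt e)" if j: "j \<in> {1..n} - {m}" for j
    proof (cases "m < j")
      case True
      have fj: "f j = e j" "e j \<le> e m" "Suc (f m) = e m" using j le f pos by auto
      \<comment> \<open>Since \<open>e j \<le> e m\<close>, the subtracted sum of the divided
        difference is empty.\<close>
      have E: "cherednik_term m j f = (\<lambda>v. \<Sum>t=f j..<Suc (f m). Psi (f(m := t, j := Suc (f m) + f j - 1 - t)) v)"
        using True fj by (simp add: cherednik_term_def div_diff_def[abs_def])
      have P: "Psi (f(m := t, j := Suc (f m) + f j - 1 - t)) \<in> pos_below (wt e)"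
        if "t \<in> {f j..<Suc (f m)}" for t
      proof (rule IH)
        show "wt (f(m := t, j := Suc (f m) + f j - 1 - t)) < wt e"
          using wt_upd2[of m j f t "Suc (f m) + f j - 1 - t"] that j m(1) f(3) by auto
      qed
      show ?thesis unfolding E using P by (rule pos_below_sum)
    next
      case False
      then have "j < m" using j by auto
      have fj: "f j = e j" "e j < e m" "Suc (f m) = e m" using j lt \<open>j < m\<close> f pos by auto
      \<comment> \<open>The subtracted sum is empty because \<open>e j < e m\<close> holds strictly:
        m is the first position of the maximum.\<close>
      have E: "cherednik_term m j f = (\<lambda>v. \<Sum>t=f j..<f m. Psi (f(m := Suc t, j := f m + f j - 1 - t)) v)"
        using False fj by (simp add: cherednik_term_def div_diff_def[abs_def])
      have P: "Psi (f(m := Suc t, j := f m + f j - 1 - t)) \<in> pos_below (wt e)"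
        if "t \<in> {f j..<f m}" for t
      proof (rule IH)
        show "wt (f(m := Suc t, j := f m + f j - 1 - t)) < wt e"
          using wt_upd2[of m j f "Suc t" "f m + f j - 1 - t"] that j m(1) f(3) by auto
      qed
      show ?thesis unfolding E using P by (rule pos_below_sum)
    qed
    ultimately have "(\<lambda>v. coord v m * (Psi f v - monomial f v) + (alpha * of_nat (f m)) * Psi f v
        + (\<Sum>j\<in>{1..n} - {m}. cherednik_term m j f v)) \<in> pos_below (wt e)"
      by (intro pos_below_add pos_below_sum) auto
    then show ?thesis by (simp add: eq)
  qed
qed

end

section \<open>Vanishing and the Knop-Sahi recursion\<close>

definition before :: "(nat \<Rightarrow> nat) \<Rightarrow> nat \<Rightarrow> nat \<Rightarrow> bool" where
  "before e k i \<longleftrightarrow> e i < e k \<or> (e k = e i \<and> k \<le> i)"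

text \<open>
  Outside \<open>{1..n}\<close> the rank is the identity, which makes it injective on all positions, as needed
  for \<open>node\<close> to be a generic point.
\<close>

definition rnk :: "nat \<Rightarrow> (nat \<Rightarrow> nat) \<Rightarrow> nat \<Rightarrow> nat" where
  "rnk n e i = (if i \<in> {1..n} then card {k \<in> {1..n}. before e k i} else i)"

lemma rnk_bounds: "i \<in> {1..n} \<Longrightarrow> rnk n e i \<in> {1..n}"
proof -
  assume i: "i \<in> {1..n}"
  have "card {k \<in> {1..n}. before e k i} \<le> card {1..n}"
    by (intro card_mono) auto
  moreover have "{i} \<subseteq> {k \<in> {1..n}. before e k i}"
    using i by (auto simp: before_def)
  then have "card {i} \<le> card {k \<in> {1..n}. before e k i}"
    by (intro card_mono) auto
  ultimately show ?thesis using i by (simp add: rnk_def)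
qed

lemma rnk_less:
  assumes "i \<in> {1..n}" "j \<in> {1..n}" "i \<noteq> j" "before e i j"
  shows "rnk n e i < rnk n e j"
proof -
  have "{k \<in> {1..n}. before e k i} \<subset> {k \<in> {1..n}. before e k j}"
  proof (intro psubsetI notI)
    show "{k \<in> {1..n}. before e k i} \<subseteq> {k \<in> {1..n}. before e k j}"
      using assms(4) by (auto simp: before_def)
    assume "{k \<in> {1..n}. before e k i} = {k \<in> {1..n}. before e k j}"
    then have "before e j i"
      using assms(2) by (auto simp: before_def)
    then show False using assms by (auto simp: before_def)
  qed
  then show ?thesis
    using assms by (auto simp: rnk_def intro!: psubset_card_mono)
qed

lemma rnk_eq_iff: "rnk n e i = rnk n e j \<longleftrightarrow> i = j"
proof -
  have "rnk n e i \<noteq> rnk n e j" if "i \<noteq> j"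
  proof -
    have "i \<in> {1..n} \<Longrightarrow> j \<in> {1..n} \<Longrightarrow> before e i j \<or> before e j i"
      by (auto simp: before_def)
    then show ?thesis
      using rnk_less[of i n j e] rnk_less[of j n i e] rnk_bounds[of i n e] rnk_bounds[of j n e] that
      by (cases "i \<in> {1..n}"; cases "j \<in> {1..n}") (auto simp: rnk_def)
  qed
  then show ?thesis by blast
qed

lemma card_bij_Collect:
  assumes "bij_betw f A A" "\<And>k. k \<in> A \<Longrightarrow> P (f k) \<longleftrightarrow> Q k"
  shows "card {k \<in> A. P k} = card {k \<in> A. Q k}"
proof -
  have "f ` {k \<in> A. Q k} = {k \<in> A. P k}"
  proof (intro set_eqI iffI)
    fix y assume "y \<in> f ` {k \<in> A. Q k}"
    then obtain k where "k \<in> A" "Q k" "y = f k" by blast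
    then show "y \<in> {k \<in> A. P k}"
      using assms(2) bij_betwE[OF assms(1)] by blast
  next
    fix y assume y: "y \<in> {k \<in> A. P k}"
    then have "y \<in> f ` A"
      using bij_betw_imp_surj_on[OF assms(1)] by simp
    then obtain k where "k \<in> A" "y = f k" by blast
    then show "y \<in> f ` {k \<in> A. Q k}"
      using assms(2) y by blast
  qed
  moreover have "inj_on f {k \<in> A. Q k}"
    using assms(1) by (auto simp: bij_betw_def intro: inj_on_subset)
  ultimately show ?thesis by (metis card_image)
qed

lemma rnk_transfer:
  assumes "bij_betw f {1..n} {1..n}" "i \<in> {1..n}"
    "\<And>k. k \<in> {1..n} \<Longrightarrow> before e k i \<longleftrightarrow> before e' (f k) (f i)"
  shows "rnk n e i = rnk n e' (f i)"
proof -
  have "card {k \<in> {1..n}. before e' k (f i)} = card {k \<in> {1..n}. before e k i}"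
    using assms(1,3) by (intro card_bij_Collect) auto
  moreover have "f i \<in> {1..n}"
    using bij_betwE[OF assms(1)] assms(2) by blast
  ultimately show ?thesis using assms(2) by (simp add: rnk_def)
qed

lemma rnk_adj:
  assumes "1 \<le> i" "i < n" "e i \<noteq> e (Suc i)"
  shows "rnk n (e \<circ> adj i) k = rnk n e (adj i k)"
proof (cases "k \<in> {1..n}")
  case True
  have "before (e \<circ> adj i) l k \<longleftrightarrow> before e (adj i l) (adj i k)" for l
    using assms(3) by (auto simp: before_def transpose_def)
  moreover have "bij_betw (adj i) {1..n} {1..n}"
    using assms by (intro bij_betw_transpose_iff) auto
  ultimately show ?thesis using True by (intro rnk_transfer)
next
  case False
  then show ?thesis using assms by (auto simp: rnk_def transpose_def)
qed

lemma rnk_tie: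
  assumes "1 \<le> i" "i < n" "e i = e (Suc i)"
  shows "rnk n e (Suc i) = Suc (rnk n e i)"
proof -
  have "{k \<in> {1..n}. before e k (Suc i)} = insert (Suc i) {k \<in> {1..n}. before e k i}"
    using assms by (auto simp: before_def le_Suc_eq)
  moreover have "Suc i \<notin> {k \<in> {1..n}. before e k i}"
    using assms by (auto simp: before_def)
  ultimately show ?thesis
    using assms by (simp add: rnk_def)
qed

text \<open>Lowering entry m by one and putting it first keeps its rank: an earlier entry precedes
  it if \<open>e i \<ge> e m\<close>, that is, if \<open>e i > e m - 1\<close>, and all later
  entries are zero.\<close>

lemma rnk_unshift:
  assumes "m \<in> {1..n}" "0 < e m" "\<And>k. m < k \<Longrightarrow> k \<le> n \<Longrightarrow> e k = 0"
  shows "rnk n (unshift m e) i = rnk n e (cyc m i)"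
proof (cases "i \<in> {1..n}")
  case True
  have "before (unshift m e) k i \<longleftrightarrow> before e (cyc m k) (cyc m i)" if k: "k \<in> {1..n}" for k
  proof -
    have "k = 1 \<or> 2 \<le> k" "i = 1 \<or> 2 \<le> i" using k True by auto
    then consider "k = 1" "i = 1" | "k = 1" "2 \<le> i" "i \<le> m" | "k = 1" "2 \<le> i" "m < i"
      | "2 \<le> k" "k \<le> m" "i = 1" | "2 \<le> k" "m < k" "i = 1" | "2 \<le> k" "2 \<le> i"
      using linorder_le_less_linear[of i m] linorder_le_less_linear[of k m] by blast
    then show ?thesis
    proof cases
      case 6
      then show ?thesis
        by (cases "k \<le> m"; cases "i \<le> m") (auto simp: before_def unshift_def cyc_def)
    qed (use assms True k in \<open>auto simp: before_def unshift_def cyc_def\<close>)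
  qed
  then show ?thesis using True assms(1) by (intro rnk_transfer bij_betw_cyc)
next
  case False
  then show ?thesis using assms(1) by (auto simp: rnk_def cyc_def)
qed

lemma rnk_zero:
  assumes "m \<in> {1..n}" "\<And>k. m \<le> k \<Longrightarrow> k \<le> n \<Longrightarrow> e k = 0"
  shows "rnk n e m = m"
proof -
  have "{k \<in> {1..n}. before e k m} = {1..m}"
  proof (intro set_eqI iffI)
    fix k assume "k \<in> {k \<in> {1..n}. before e k m}"
    then show "k \<in> {1..m}"
      using assms(1) assms(2)[of k] by (cases "k \<le> m") (auto simp: before_def)
  next
    fix k assume "k \<in> {1..m}"
    then show "k \<in> {k \<in> {1..n}. before e k m}"
      using assms(1) assms(2)[of m] by (auto simp: before_def)
  qed
  then show ?thesis using assms(1) by (simp add: rnk_def)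
qed

section \<open>The interpolation points and the operators evaluated there\<close>

context interpolation_dim
begin

definition comps :: "(nat \<Rightarrow> nat) set" where
  "comps = {e. \<forall>i. i \<notin> {1..n} \<longrightarrow> e i = 0}"

lemma comps_adj: "e \<in> comps \<Longrightarrow> 1 \<le> i \<Longrightarrow> i < n \<Longrightarrow> e \<circ> adj i \<in> comps"
  by (auto simp: comps_def transpose_def)

lemma comps_unshift: "e \<in> comps \<Longrightarrow> m \<in> {1..n} \<Longrightarrow> unshift m e \<in> comps"
  by (auto simp: comps_def unshift_def cyc_def)

lemma comps_shift: "e \<in> comps \<Longrightarrow> m \<in> {1..n} \<Longrightarrow> shift m e \<in> comps"
  by (auto simp: comps_def shift_def)

lemma comps_wt_0: "e \<in> comps \<Longrightarrow> wt e = 0 \<Longrightarrow> e = (\<lambda>i. 0)"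
  using le_wt[of _ e] by (auto simp: comps_def)

text \<open>This is -alpha times the interpolation point of e (\<open>target_node\<close>), in line
  with the substitution that leads from E to B.\<close>

definition node :: "(nat \<Rightarrow> nat) \<Rightarrow> point" where
  "node e = Point (\<lambda>i. - (alpha * of_nat (e i) + of_nat n - of_nat (rnk n e i)))"

text \<open>The part of a coordinate difference that is free of alpha is a difference of ranks,
  nonzero at distinct positions.\<close>

lemma coord_node: "coord (node e) i = - (alpha * of_nat (e i) + of_nat n - of_nat (rnk n e i))"
proof -
  have "- (alpha * of_nat (e i) + of_nat n - of_nat (rnk n e i))
      - - (alpha * of_nat (e j) + of_nat n - of_nat (rnk n e j)) \<noteq> of_int k * alpha"
    if "i \<noteq> j" for i j and k :: int
  proof
    assume "- (alpha * of_nat (e i) + of_nat n - of_nat (rnk n e i))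
      - - (alpha * of_nat (e j) + of_nat n - of_nat (rnk n e j)) = of_int k * alpha"
    then have "of_int (int (rnk n e i) - int (rnk n e j)) + of_int (int (e j) - int (e i) - k) * alpha = 0"
      by (simp add: algebra_simps)
    then have "rnk n e i = rnk n e j"
      by (drule_tac of_int_alpha_independent) simp
    with that show False by (simp add: rnk_eq_iff)
  qed
  then show ?thesis by (simp add: node_def Point_inverse)
qed

lemma swap_node:
  assumes "1 \<le> i" "i < n" "e i \<noteq> e (Suc i)"
  shows "swap_pt i (node e) = node (e \<circ> adj i)"
  by (rule point_eqI) (simp add: coord_swap_pt coord_node rnk_adj[OF assms])

lemma rot_node:
  assumes "0 < e n"
  shows "rot_pt (node e) = node (unshift n e)"
proof (rule point_eqI)
  fix i
  have "rnk n (unshift n e) i = rnk n e (cyc n i)"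
    using assms n_pos by (intro rnk_unshift) auto
  moreover have "cyc n 1 = n" by (simp add: cyc_def)
  ultimately show "coord (rot_pt (node e)) i = coord (node (unshift n e)) i"
    using assms by (auto simp: coord_rot_pt coord_node unshift_def of_nat_diff algebra_simps)
qed

text \<open>Equal neighbours have consecutive ranks, so the coordinates differ by -1 and the
  coefficient of the value at the swapped point, which is no node, vanishes.\<close>

lemma sig_node_tie:
  assumes "1 \<le> i" "i < n" "e i = e (Suc i)"
  shows "sig i f (node e) = f (node e)"
proof -
  have "coord (node e) i - coord (node e) (Suc i) = - 1"
    using assms by (simp add: coord_node rnk_tie)
  then show ?thesis by (simp add: sig_def)
qed

lemma sig_node:
  assumes "1 \<le> i" "i < n" "e i \<noteq> e (Suc i)"
  shows "sig i f (node e) = (1 + 1 / (coord (node e) i - coord (node e) (Suc i))) * f (node (e \<circ> adj i))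
    - f (node e) / (coord (node e) i - coord (node e) (Suc i))"
  by (simp add: sig_def swap_node[OF assms])

text \<open>If \<open>e n = 0\<close>, position n is ranked last, so its coordinate is zero and
  kills the factor \<open>x_n\<close>. Otherwise the rotated node is again a node.\<close>

lemma Phi_node: "Phi f (node e) = (if e n = 0 then 0 else coord (node e) n * f (node (unshift n e)))"
proof (cases "e n = 0")
  case True
  then have "rnk n e n = n"
    using n_pos by (intro rnk_zero) auto
  then have "coord (node e) n = 0"
    using True by (simp add: coord_node)
  then show ?thesis using True by (simp add: Phi_def)
next
  case False
  then show ?thesis by (simp add: Phi_def rot_node)
qed

definition supported :: "nat \<Rightarrow> (nat \<Rightarrow> nat) set \<Rightarrow> (point \<Rightarrow> Qr) \<Rightarrow> bool" where
  "supported d S f \<longleftrightarrow> (\<forall>e\<in>comps. wt e \<le> d \<longrightarrow> e \<notin> S \<longrightarrow> f (node e) = 0)"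

section \<open>One recursion step, where m is the last nonzero position of e\<close>

context
  fixes e m f
  assumes e: "e \<in> comps" and m: "m \<in> {1..n}" "0 < e m" "\<And>k. m < k \<Longrightarrow> e k = 0"
    and f: "supported (wt e - 1) {unshift m e} f"
begin

definition moved :: "nat \<Rightarrow> nat \<Rightarrow> nat" where
  "moved k = e(m := 0, k := e m)"

lemma moved_m: "moved m = e"
  by (auto simp: moved_def)

lemma moved_zero: "k \<noteq> i \<Longrightarrow> m \<le> i \<Longrightarrow> moved k i = 0"
  using m(3)[of i] by (auto simp: moved_def)

lemma moved_adj:
  assumes "m \<le> k"
  shows "moved (Suc k) \<circ> adj k = moved k"
proof
  fix i
  show "(moved (Suc k) \<circ> adj k) i = moved k i"
    using assms m(3)[of k] m(3)[of "Suc k"] by (cases "k = m") (auto simp: moved_def transpose_def)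
qed

lemma moved_inj: "m \<le> k \<Longrightarrow> m \<le> l \<Longrightarrow> moved k = moved l \<Longrightarrow> k = l"
  using m(2) moved_zero[of l k] by (metis fun_upd_same less_numeral_extra(3) moved_def)

lemma supported_Phi: "supported (wt e) {moved n} (Phi f)"
  unfolding supported_def
proof (intro ballI impI)
  fix g assume g: "g \<in> comps" "wt g \<le> wt e" "g \<notin> {moved n}"
  show "Phi f (node g) = 0"
  proof (cases "g n = 0")
    case False
    then have "unshift n g \<in> comps" "wt (unshift n g) \<le> wt e - 1"
      using comps_unshift[of g n] wt_unshift[of n g] g n_pos by auto
    moreover have "unshift n g \<noteq> unshift m e"
    proof
      assume "unshift n g = unshift m e"
      then have "g = shift n (unshift m e)"
        using shift_unshift[of n g] False n_pos by simp
      moreover have "shift n (unshift m e) i = moved n i" for i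
      proof -
        have "e i = 0" if "i = 0 \<or> n < i"
          using e that by (auto simp: comps_def)
        then show ?thesis
          using m m(3)[of i] m(3)[of "Suc i"] by (auto simp: shift_def unshift_def moved_def cyc_def)
      qed
      ultimately show False using g by blast
    qed
    ultimately show ?thesis
      using f by (simp add: Phi_node supported_def)
  qed (simp add: Phi_node)
qed

text \<open>\<open>sig k\<close> mixes a node with its swap at k, k + 1. The swap turns
  \<open>moved (k + 1)\<close> into \<open>moved k\<close>, while every \<open>moved l\<close> with
  l > k + 1 has zeros at both positions.\<close>

lemma supported_Theta:
  assumes "k \<le> n" "m \<le> k"
  shows "supported (wt e) (moved ` {k..n}) (Theta k f)"
  using assms
proof (induction k rule: inc_induct)
  case base
  then show ?case using supported_Phi by (simp add: Theta_n)
next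
  case (step k)
  then have IH: "supported (wt e) (moved ` {Suc k..n}) (Theta (Suc k) f)" by simp
  have k: "1 \<le> k" "k < n" using step m(1) by auto
  show ?case unfolding supported_def
  proof (intro ballI impI)
    fix g assume g: "g \<in> comps" "wt g \<le> wt e" "g \<notin> moved ` {k..n}"
    have "g \<notin> moved ` {Suc k..n}" using g(3) by auto
    then have 0: "Theta (Suc k) f (node g) = 0"
      using IH g by (simp add: supported_def)
    show "Theta k f (node g) = 0"
    proof (cases "g k = g (Suc k)")
      case True
      then show ?thesis using 0 k by (simp add: Theta_rec sig_node_tie)
    next
      case False
      have "g \<circ> adj k \<notin> moved ` {Suc k..n}"
      proof
        assume "g \<circ> adj k \<in> moved ` {Suc k..n}"
        then obtain l where l: "g \<circ> adj k = moved l" "Suc k \<le> l" by auto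
        have "g = g \<circ> adj k \<circ> adj k" by (simp add: comp_assoc)
        then have gl: "g = moved l \<circ> adj k" using l(1) by metis
        show False
        proof (cases "l = Suc k")
          case True
          then have "g = moved k" using gl moved_adj step.prems by simp
          then show False using g(3) k by auto
        next
          case l': False
          have "g k = moved l (Suc k)" "g (Suc k) = moved l k"
            unfolding gl by (simp_all)
          then show False
            using False l' l(2) step.prems moved_zero[of l k] moved_zero[of l "Suc k"] by simp
        qed
      qed
      then have "Theta (Suc k) f (node (g \<circ> adj k)) = 0"
        using IH g k by (simp add: supported_def comps_adj wt_adj)
      then show ?thesis using 0 k False by (simp add: Theta_rec sig_node)
    qed
  qed
qed

text \<open>For k = m this is the hook factor of the box (m, 1); in general it is the coordinate
  difference in \<open>node_moved_diff\<close>.\<close>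

definition hook_shift :: "nat \<Rightarrow> Qr" where
  "hook_shift k = alpha * of_nat (e m) + of_nat (card {i \<in> {1..<m}. e i < e m} + 1 + (k - m))"

lemma hook_shift_nonzero: "hook_shift k \<noteq> 0"
proof
  assume "hook_shift k = 0"
  then have "of_int (int (card {i \<in> {1..<m}. e i < e m} + 1 + (k - m))) + of_int (int (e m)) * alpha = 0"
    unfolding hook_shift_def by (simp add: algebra_simps)
  then show False
    using m(2) of_int_alpha_independent by fastforce
qed

text \<open>In \<open>moved (Suc k)\<close> the zero at k is ranked k + 1, and the moved entry is
  preceded exactly by the i < m with \<open>e i \<ge> e m\<close>.\<close>

lemma node_moved_diff:
  assumes "m \<le> k" "k < n"
  shows "coord (node (moved (Suc k))) k - coord (node (moved (Suc k))) (Suc k) = hook_shift k"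
proof -
  let ?g = "moved (Suc k)"
  have val: "?g k = 0" "?g (Suc k) = e m"
    using assms moved_zero[of "Suc k" k] by (simp_all add: moved_def)
  have lt: "?g i = e i" if "i < m" for i
    using that assms by (auto simp: moved_def)
  have "{i \<in> {1..n}. before ?g i k} = {1..Suc k}"
  proof (intro set_eqI iffI)
    fix i assume i: "i \<in> {i \<in> {1..n}. before ?g i k}"
    show "i \<in> {1..Suc k}"
      using i assms moved_zero[of "Suc k" i] by (cases "i \<le> Suc k") (auto simp: before_def val)
  next
    fix i assume i: "i \<in> {1..Suc k}"
    then show "i \<in> {i \<in> {1..n}. before ?g i k}"
      using assms m(2) val by (cases "i = Suc k") (auto simp: before_def)
  qed
  then have r1: "rnk n ?g k = Suc k"
    using assms m(1) by (simp add: rnk_def)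
  have "{i \<in> {1..n}. before ?g i (Suc k)} = insert (Suc k) {i \<in> {1..<m}. \<not> e i < e m}"
  proof (intro set_eqI iffI)
    fix i assume i: "i \<in> {i \<in> {1..n}. before ?g i (Suc k)}"
    show "i \<in> insert (Suc k) {i \<in> {1..<m}. \<not> e i < e m}"
    proof (cases "i = Suc k")
      case False
      then have "i < m"
        using i moved_zero[of "Suc k" i] m(2) by (cases "i < m") (auto simp: before_def val)
      then show ?thesis
        using i lt by (auto simp: before_def val)
    qed simp
  next
    fix i assume i: "i \<in> insert (Suc k) {i \<in> {1..<m}. \<not> e i < e m}"
    then show "i \<in> {i \<in> {1..n}. before ?g i (Suc k)}"
      using assms m(1) lt[of i] by (cases "i = Suc k") (auto simp: before_def val)
  qed
  moreover have "Suc k \<notin> {i \<in> {1..<m}. \<not> e i < e m}"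
    using assms by auto
  ultimately have r2: "rnk n ?g (Suc k) = Suc (card {i \<in> {1..<m}. \<not> e i < e m})"
    using assms by (simp add: rnk_def)
  have "card ({i \<in> {1..<m}. e i < e m} \<union> {i \<in> {1..<m}. \<not> e i < e m})
      = card {i \<in> {1..<m}. e i < e m} + card {i \<in> {1..<m}. \<not> e i < e m}"
    by (intro card_Un_disjoint) auto
  moreover have "{i \<in> {1..<m}. e i < e m} \<union> {i \<in> {1..<m}. \<not> e i < e m} = {1..<m}" by auto
  ultimately have "card {i \<in> {1..<m}. e i < e m} + card {i \<in> {1..<m}. \<not> e i < e m} = m - 1" by simp
  then have "card {i \<in> {1..<m}. e i < e m} + 1 + (k - m) + rnk n ?g (Suc k) = rnk n ?g k"
    unfolding r1 r2 using assms m(1) by simp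
  then have "(of_nat (rnk n ?g k) :: Qr)
      = of_nat (card {i \<in> {1..<m}. e i < e m} + 1 + (k - m)) + of_nat (rnk n ?g (Suc k))"
    by (simp only: of_nat_add flip: of_nat_add)
  then show ?thesis
    unfolding hook_shift_def coord_node val by (simp only:) (simp add: algebra_simps)
qed

text \<open>
  At the interpolation points, \<open>partial_sum k\<close> is up to a nonzero factor \<open>sig k + 1 / hook_shift k\<close>
  applied to \<open>partial_sum (Suc k)\<close>, and this operator annihilates the value at \<open>moved (Suc k)\<close>.
\<close>

definition partial_sum :: "nat \<Rightarrow> point \<Rightarrow> Qr" where
  "partial_sum k v = hook_shift k * Theta k f v + (\<Sum>l=Suc k..n. Theta l f v)"

lemma supported_partial_sum:
  assumes "k \<le> n" "m \<le> k"
  shows "supported (wt e) {moved k} (partial_sum k)"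
  using assms
proof (induction k rule: inc_induct)
  case base
  then show ?case
    using supported_Theta[of n] by (simp add: supported_def partial_sum_def)
next
  case (step k)
  then have IH: "supported (wt e) {moved (Suc k)} (partial_sum (Suc k))" by simp
  have k: "1 \<le> k" "k < n" "m \<le> k" using step m(1) by auto
  let ?S = "partial_sum (Suc k)"
  have hs: "hook_shift (Suc k) = hook_shift k + 1"
    using k by (simp add: hook_shift_def Suc_diff_le)
  have S_eq: "?S = (\<lambda>v. hook_shift (Suc k) * Theta (Suc k) f v + (\<Sum>l=Suc (Suc k)..n. Theta l f v))"
    by (simp add: partial_sum_def fun_eq_iff)
  show ?case unfolding supported_def
  proof (intro ballI impI)
    fix g assume g: "g \<in> comps" "wt g \<le> wt e" "g \<notin> {moved k}"
    \<comment> \<open>Either g has equal entries at k and k + 1, or both values vanish because the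
      support of \<open>Theta l f\<close> has zeros there.\<close>
    have fix_l: "sig k (Theta l f) (node g) = Theta l f (node g)" if l: "l \<in> {Suc (Suc k)..n}" for l
    proof (cases "g k = g (Suc k)")
      case True
      then show ?thesis using k by (simp add: sig_node_tie)
    next
      case False
      have "h \<notin> moved ` {l..n}" if "h k \<noteq> h (Suc k)" for h
        using that l k by (auto simp: moved_zero)
      then have "g \<notin> moved ` {l..n}" "g \<circ> adj k \<notin> moved ` {l..n}"
        using False by simp_all
      then have "Theta l f (node g) = 0" "Theta l f (node (g \<circ> adj k)) = 0"
        using supported_Theta[of l] l k g by (simp_all add: supported_def comps_adj wt_adj)
      then show ?thesis using k False by (simp add: sig_node)
    qed
    have "sig k ?S (node g) = hook_shift (Suc k) * Theta k f (node g) + (\<Sum>l=Suc (Suc k)..n. sig k (Theta l f) (node g))"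
      unfolding S_eq by (simp only: sig_add sig_cmult sig_sum Theta_rec[OF k(2)])
    also have "(\<Sum>l=Suc (Suc k)..n. sig k (Theta l f) (node g)) = (\<Sum>l=Suc (Suc k)..n. Theta l f (node g))"
      using fix_l by (intro sum.cong) auto
    finally have sS: "sig k ?S (node g) = hook_shift (Suc k) * Theta k f (node g) + (\<Sum>l=Suc (Suc k)..n. Theta l f (node g))" .
    have Sg: "?S (node g) = hook_shift (Suc k) * Theta (Suc k) f (node g) + (\<Sum>l=Suc (Suc k)..n. Theta l f (node g))"
      by (simp add: partial_sum_def)
    have "partial_sum k (node g) = hook_shift k * Theta k f (node g) + Theta (Suc k) f (node g) + (\<Sum>l=Suc (Suc k)..n. Theta l f (node g))"
      using k by (simp add: partial_sum_def sum.atLeast_Suc_atMost)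
    \<comment> \<open>The sum over l > k + 1 receives the coefficient
      \<open>hook_shift k + 1 = hook_shift (Suc k)\<close>, so this factor is common to all
      terms.\<close>
    then have eq: "hook_shift (Suc k) * partial_sum k (node g) = hook_shift k * sig k ?S (node g) + ?S (node g)"
      unfolding sS Sg by (simp add: hs algebra_simps)
    have "hook_shift k * sig k ?S (node g) + ?S (node g) = 0"
    proof (cases "g = moved (Suc k)")
      case True
      have ne: "g k \<noteq> g (Suc k)"
        using True k m(2) moved_zero[of "Suc k" k] by (simp add: moved_def)
      have "g \<circ> adj k = moved k"
        using True moved_adj k by simp
      moreover have "moved k \<noteq> moved (Suc k)"
        using moved_inj[of k "Suc k"] k by auto
      ultimately have "?S (node (g \<circ> adj k)) = 0"
        using IH g k by (metis comps_adj singletonD supported_def wt_adj)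
      moreover have "coord (node g) k - coord (node g) (Suc k) = hook_shift k"
        using node_moved_diff True k by simp
      ultimately have "sig k ?S (node g) = - ?S (node g) / hook_shift k"
        using ne k by (simp add: sig_node)
      then show ?thesis using hook_shift_nonzero[of k] by simp
    next
      case False
      then have 0: "?S (node g) = 0"
        using IH g by (simp add: supported_def)
      have "sig k ?S (node g) = 0"
      proof (cases "g k = g (Suc k)")
        case True
        then show ?thesis using 0 k by (simp add: sig_node_tie)
      next
        case ne: False
        have "g \<circ> adj k \<noteq> moved (Suc k)"
        proof
          assume "g \<circ> adj k = moved (Suc k)"
          then have "g \<circ> adj k \<circ> adj k = moved (Suc k) \<circ> adj k" by metis
          then have "g = moved k"
            using moved_adj[of k] k by (simp add: comp_assoc)
          then show False using g by simp
        qed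
        then have "?S (node (g \<circ> adj k)) = 0"
          using IH g k by (simp add: supported_def comps_adj wt_adj)
        then show ?thesis using 0 k ne by (simp add: sig_node)
      qed
      then show ?thesis using 0 by simp
    qed
    then show "partial_sum k (node g) = 0"
      using eq hook_shift_nonzero[of "Suc k"] by simp
  qed
qed

lemma supported_step:
  "supported (wt e) {e} (\<lambda>v. hook_shift m * Theta m f v + (\<Sum>l=Suc m..n. Theta l f v))"
  using supported_partial_sum[of m] m(1) by (simp add: moved_m partial_sum_def[abs_def])

end

end

section \<open>Hook products\<close>

definition legs :: "nat \<Rightarrow> (nat \<Rightarrow> nat) \<Rightarrow> nat \<Rightarrow> nat \<Rightarrow> nat" where
  "legs n e i j = card {k \<in> {1..n}. (i < k \<and> j \<le> e k \<and> e k \<le> e i) \<or> (k < i \<and> j \<le> e k + 1 \<and> e k + 1 \<le> e i)}"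

definition hook :: "nat \<Rightarrow> (nat \<Rightarrow> nat) \<Rightarrow> nat \<Rightarrow> nat \<Rightarrow> Qr" where
  "hook n e i j = alpha * (of_nat (e i - j) + 1) + of_nat (legs n e i j) + 1"

definition hooks :: "nat \<Rightarrow> (nat \<Rightarrow> nat) \<Rightarrow> Qr" where
  "hooks n e = (\<Prod>i=1..n. \<Prod>j=1..e i. hook n e i j)"

text \<open>Deleting the box (m, 1) and moving the rest of row m to the top yields the diagram of
  \<open>unshift m e\<close>. The bijection \<open>cyc m\<close> preserves the legs of all remaining
  boxes, so the quotient is the hook factor of the deleted box.\<close>

lemma hooks_unshift:
  assumes m: "m \<in> {1..n}" "0 < e m" "\<And>k. m < k \<Longrightarrow> k \<le> n \<Longrightarrow> e k = 0"
  shows "hooks n e = (alpha * of_nat (e m) + of_nat (card {i \<in> {1..<m}. e i < e m} + 1)) * hooks n (unshift m e)"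
proof -
  let ?e = "unshift m e"
  define row where "row e i = (\<Prod>j=1..e i. hook n e i j)" for e i
  have cyc1: "cyc m 1 = m" by (simp add: cyc_def)
  have e1: "?e 1 = e m - 1" by (simp add: unshift_def)
  have e2: "?e i = e (cyc m i)" if "i \<noteq> 1" for i
    using that by (simp add: unshift_def)
  have legs: "legs n e (cyc m i) j = legs n ?e i j"
    if "i \<in> {2..m}" "1 \<le> j" for i j
    unfolding legs_def
  proof (rule card_bij_Collect[OF bij_betw_cyc[OF m(1)]])
    fix k assume k: "k \<in> {1..n}"
    then consider "k = 1" | "2 \<le> k" "k \<le> m" | "2 \<le> k" "m < k" by fastforce
    then show "(cyc m i < cyc m k \<and> j \<le> e (cyc m k) \<and> e (cyc m k) \<le> e (cyc m i) \<or>
        cyc m k < cyc m i \<and> j \<le> e (cyc m k) + 1 \<and> e (cyc m k) + 1 \<le> e (cyc m i)) \<longleftrightarrow>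
        (i < k \<and> j \<le> ?e k \<and> ?e k \<le> ?e i \<or> k < i \<and> j \<le> ?e k + 1 \<and> ?e k + 1 \<le> ?e i)"
    proof cases
      case 1
      then have "cyc m k = m" "cyc m i < m" "?e k + 1 = e m" "k < i" "?e i = e (cyc m i)"
        using that m(2) e1 e2[of i] by (auto simp: cyc_def)
      then show ?thesis by auto
    next
      case 2
      then have "cyc m k = k - 1" "cyc m i = i - 1" "?e k = e (k - 1)" "?e i = e (i - 1)"
        using that e2[of i] e2[of k] by (auto simp: cyc_def)
      moreover have "i - 1 < k - 1 \<longleftrightarrow> i < k" "k - 1 < i - 1 \<longleftrightarrow> k < i"
        using that 2 by auto
      ultimately show ?thesis by simp
    next
      case 3
      then have "cyc m k = k" "e k = 0" "?e k = 0" "cyc m i < k" "i < k"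
        using that e2[of k] m(3)[of k] k by (auto simp: cyc_def)
      then show ?thesis using that by auto
    qed
  qed
  have legs1: "legs n e m (Suc j) = legs n ?e 1 j" if "1 \<le> j" for j
    unfolding legs_def
  proof (rule card_bij_Collect[OF bij_betw_cyc[OF m(1)]])
    fix k assume k: "k \<in> {1..n}"
    then consider "k = 1" | "2 \<le> k" "k \<le> m" | "2 \<le> k" "m < k" by fastforce
    then show "(m < cyc m k \<and> Suc j \<le> e (cyc m k) \<and> e (cyc m k) \<le> e m \<or>
        cyc m k < m \<and> Suc j \<le> e (cyc m k) + 1 \<and> e (cyc m k) + 1 \<le> e m) \<longleftrightarrow>
        (1 < k \<and> j \<le> ?e k \<and> ?e k \<le> ?e 1 \<or> k < 1 \<and> j \<le> ?e k + 1 \<and> ?e k + 1 \<le> ?e 1)"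
    proof cases
      case 1
      then show ?thesis using cyc1 by auto
    next
      case 2
      then have "cyc m k = k - 1" "?e k = e (k - 1)"
        using e2[of k] by (auto simp: cyc_def)
      then show ?thesis using 2 m(2) e1 by auto
    next
      case 3
      then have "cyc m k = k" "e k = 0" "?e k = 0"
        using e2[of k] m(3)[of k] k by (auto simp: cyc_def)
      then show ?thesis using that 3 by auto
    qed
  qed
  have row: "row e (cyc m i) = row ?e i" if "i \<in> {1..n} - {1}" for i
  proof (cases "i \<le> m")
    case True
    then have "i \<in> {2..m}" using that by auto
    moreover have "?e i = e (cyc m i)" using e2 that by simp
    ultimately show ?thesis
      unfolding row_def by (intro prod.cong) (auto simp: hook_def legs)
  next
    case False
    then have "cyc m i = i" "e i = 0" "?e i = 0"
      using that m(3)[of i] e2[of i] by (auto simp: cyc_def)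
    then show ?thesis by (simp add: row_def)
  qed
  have "row e m = hook n e m 1 * (\<Prod>j=Suc 1..Suc (e m - 1). hook n e m j)"
    unfolding row_def using m(2) by (subst prod.atLeast_Suc_atMost) auto
  also have "(\<Prod>j=Suc 1..Suc (e m - 1). hook n e m j) = (\<Prod>j=1..e m - 1. hook n e m (Suc j))"
    by (rule prod.shift_bounds_cl_Suc_ivl)
  also have "\<dots> = row ?e 1"
    unfolding row_def e1 by (intro prod.cong) (auto simp: hook_def legs1[unfolded One_nat_def] e1[unfolded One_nat_def])
  finally have row_m: "row e m = hook n e m 1 * row ?e 1" .
  \<comment> \<open>The leg of the box (m, 1): the entries after m are zero and do not
    count.\<close>
  have "{k \<in> {1..n}. (m < k \<and> 1 \<le> e k \<and> e k \<le> e m) \<or> (k < m \<and> 1 \<le> e k + 1 \<and> e k + 1 \<le> e m)}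
      = {i \<in> {1..<m}. e i < e m}"
    using m by (auto simp: Suc_le_eq)
  then have hook_m: "hook n e m 1 = alpha * of_nat (e m) + of_nat (card {i \<in> {1..<m}. e i < e m} + 1)"
    unfolding hook_def legs_def using m(2) by (simp add: of_nat_diff add.assoc)
  have "hooks n e = (\<Prod>i=1..n. row e (cyc m i))"
    unfolding hooks_def row_def[symmetric] by (rule prod.reindex_bij_betw[OF bij_betw_cyc[OF m(1)], symmetric])
  also have "\<dots> = row e m * (\<Prod>i\<in>{1..n} - {1}. row e (cyc m i))"
    using m(1) cyc1 by (subst prod.remove[of _ 1]) auto
  also have "(\<Prod>i\<in>{1..n} - {1}. row e (cyc m i)) = (\<Prod>i\<in>{1..n} - {1}. row ?e i)"
    using row by (rule prod.cong[OF refl])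
  also have "row e m * \<dots> = hook n e m 1 * (row ?e 1 * (\<Prod>i\<in>{1..n} - {1}. row ?e i))"
    by (simp add: row_m)
  also have "row ?e 1 * (\<Prod>i\<in>{1..n} - {1}. row ?e i) = hooks n ?e"
    unfolding hooks_def row_def[symmetric] using m(1) by (intro prod.remove[symmetric]) auto
  finally show ?thesis by (simp only: hook_m)
qed

section \<open>Coefficients of the integral nonsymmetric Jack polynomials\<close>

context interpolation_dim
begin

definition comps_of :: "nat \<Rightarrow> (nat \<Rightarrow> nat) set" where
  "comps_of d = {e \<in> comps. wt e = d}"

lemma finite_comps_of: "finite (comps_of d)"
proof (rule finite_subset)
  show "comps_of d \<subseteq> {e. \<forall>i. (i \<in> {1..n} \<longrightarrow> e i \<in> {..d}) \<and> (i \<notin> {1..n} \<longrightarrow> e i = 0)}"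
    using le_wt by (auto simp: comps_of_def comps_def)
  show "finite {e. \<forall>i. (i \<in> {1..n} \<longrightarrow> e i \<in> {..d}) \<and> (i \<notin> {1..n} \<longrightarrow> e i = (0::nat))}"
    by (rule finite_set_of_finite_funs) auto
qed

text \<open>\<open>Theta k\<close> sends \<open>Psi g\<close> to \<open>Psi (shift k g)\<close>, and
  \<open>shift k\<close> is a bijection from degree d onto the compositions of degree d + 1 with
  nonzero entry k.\<close>

lemma Theta_expansion:
  assumes "k \<in> {1..n}"
  shows "Theta k (\<lambda>v. \<Sum>g\<in>comps_of d. J g * Psi g v)
    = (\<lambda>v. \<Sum>g\<in>comps_of (Suc d). (if 0 < g k then J (unshift k g) else 0) * Psi g v)"
proof
  fix v
  have wt_shift: "wt (shift k g) = Suc (wt g)" for g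
    using wt_unshift[of k "shift k g"] assms unshift_shift[of k g] by (simp add: shift_def)
  have wt_un: "wt (unshift k g) = wt g - 1" if "0 < g k" for g
    using wt_unshift[of k g] assms that by simp
  have "(\<Sum>g\<in>comps_of (Suc d). (if 0 < g k then J (unshift k g) else 0) * Psi g v)
      = (\<Sum>g\<in>comps_of (Suc d). if 0 < g k then J (unshift k g) * Psi g v else 0)"
    by (intro sum.cong) auto
  also have "\<dots> = (\<Sum>g\<in>{g \<in> comps_of (Suc d). 0 < g k}. J (unshift k g) * Psi g v)"
    using finite_comps_of by (rule sum.inter_filter[symmetric])
  also have "\<dots> = (\<Sum>g\<in>comps_of d. J g * Psi (shift k g) v)"
    using assms
    by (intro sum.reindex_bij_witness[of _ "shift k" "unshift k"])
      (auto simp: comps_of_def shift_unshift unshift_shift comps_shift comps_unshift wt_shift wt_un,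
        auto simp: shift_def)
  also have "\<dots> = Theta k (\<lambda>v. \<Sum>g\<in>comps_of d. J g * Psi g v) v"
    using assms by (simp add: Theta_sum Theta_cmult Theta_Psi)
  finally show "Theta k (\<lambda>v. \<Sum>g\<in>comps_of d. J g * Psi g v) v
    = (\<Sum>g\<in>comps_of (Suc d). (if 0 < g k then J (unshift k g) else 0) * Psi g v)" ..
qed

text \<open>
  The coefficients \<open>J\<close> are those of the integral form of the nonsymmetric Jack polynomial; applying
  \<open>Psi\<close> to it gives the interpolation polynomial.
\<close>

theorem Jack_coefficients:
  assumes "e \<in> comps"
  shows "\<exists>J. range J \<subseteq> nonneg_alpha \<and> J e = hooks n e \<and>
    supported (wt e) {e} (\<lambda>v. \<Sum>g\<in>comps_of (wt e). J g * Psi g v)"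
  using assms
proof (induction "wt e" arbitrary: e)
  case 0
  then have e: "e = (\<lambda>i. 0)" using comps_wt_0 by simp
  have "range (\<lambda>g. if g = e then 1 else 0) \<subseteq> nonneg_alpha"
    using nonneg_alpha_0 nonneg_alpha_1 by auto
  moreover have "hooks n e = 1"
    by (simp add: hooks_def e)
  moreover have "supported (wt e) {e} f" for f
    unfolding supported_def
  proof (intro ballI impI)
    fix g assume "g \<in> comps" "wt g \<le> wt e" "g \<notin> {e}"
    then show "f (node g) = 0"
      using comps_wt_0[of g] 0(1) e by simp
  qed
  ultimately show ?case
    by (intro exI[of _ "\<lambda>g. if g = e then 1 else 0"]) simp
next
  case (Suc d)
  define m where "m = Max {i \<in> {1..n}. 0 < e i}"
  have "\<exists>i\<in>{1..n}. 0 < e i"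
    using Suc.hyps(2) by (intro wt_pos) simp
  then have "m \<in> {i \<in> {1..n}. 0 < e i}"
    unfolding m_def by (intro Max_in) auto
  then have m: "m \<in> {1..n}" "0 < e m" by auto
  have zero: "e k = 0" if "m < k" for k
  proof (cases "k \<in> {1..n}")
    case True
    show ?thesis
    proof (rule ccontr)
      assume "e k \<noteq> 0"
      then have "k \<le> m"
        unfolding m_def using True by (intro Max_ge) auto
      with that show False by simp
    qed
  qed (use Suc.prems in \<open>simp add: comps_def\<close>)
  define e' where "e' = unshift m e"
  have e': "d = wt e'" "e' \<in> comps"
    using wt_unshift[of m e] m Suc by (auto simp: e'_def comps_unshift)
  obtain J where J: "range J \<subseteq> nonneg_alpha" "J e' = hooks n e'"
    "supported d {e'} (\<lambda>v. \<Sum>g\<in>comps_of d. J g * Psi g v)"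
    using Suc.hyps(1)[OF e'] e'(1) by auto
  define f where "f = (\<lambda>v. \<Sum>g\<in>comps_of d. J g * Psi g v)"
  \<comment> \<open>The factor \<open>hook_shift m\<close> of \<open>Theta m\<close> in
    \<open>supported_step\<close>, and at the same time the new hook factor in
    \<open>hooks_unshift\<close>.\<close>
  define c where "c = alpha * of_nat (e m) + of_nat (card {i \<in> {1..<m}. e i < e m} + 1)"
  define T where "T k g = (if 0 < g k then J (unshift k g) else 0)" for k g
  define J' where "J' g = c * T m g + (\<Sum>l=Suc m..n. T l g)" for g
  have T: "Theta k f v = (\<Sum>g\<in>comps_of (wt e). T k g * Psi g v)" if "k \<in> {1..n}" for k v
    using Theta_expansion[OF that, of J d] Suc.hyps(2) by (simp add: f_def T_def)
  have "(\<Sum>g\<in>comps_of (wt e). J' g * Psi g v) = c * Theta m f v + (\<Sum>l=Suc m..n. Theta l f v)" for v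
  proof -
    have "(\<Sum>l=Suc m..n. Theta l f v) = (\<Sum>l=Suc m..n. \<Sum>g\<in>comps_of (wt e). T l g * Psi g v)"
      using m by (intro sum.cong) (auto simp: T)
    also have "\<dots> = (\<Sum>g\<in>comps_of (wt e). (\<Sum>l=Suc m..n. T l g) * Psi g v)"
      by (subst sum.swap) (simp add: sum_distrib_right)
    finally show ?thesis
      using T[OF m(1)] by (simp add: J'_def algebra_simps sum.distrib sum_distrib_left)
  qed
  moreover have "supported (wt e) {e} (\<lambda>v. c * Theta m f v + (\<Sum>l=Suc m..n. Theta l f v))"
  proof -
    have "d = wt e - 1" using Suc.hyps(2) by simp
    then have "supported (wt e - 1) {unshift m e} f"
      using J(3) by (simp only: f_def e'_def)
    moreover have "hook_shift e m m = c"
      by (simp only: hook_shift_def[OF Suc.prems m zero calculation] c_def diff_self_eq_0 add_0_right)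
    ultimately show ?thesis
      using supported_step[OF Suc.prems m zero, of f] by simp
  qed
  ultimately have "supported (wt e) {e} (\<lambda>v. \<Sum>g\<in>comps_of (wt e). J' g * Psi g v)"
    by simp
  moreover have "J' e = hooks n e"
  proof -
    \<comment> \<open>Entries of e after m are zero, so only \<open>Theta m\<close> contributes to
      the coefficient at e.\<close>
    have "(\<Sum>l=Suc m..n. T l e) = 0"
      by (intro sum.neutral) (auto simp: T_def zero)
    then show ?thesis
      using hooks_unshift[of m n e] m zero J(2) by (simp add: J'_def T_def c_def e'_def)
  qed
  moreover have "J' g \<in> nonneg_alpha" for g
  proof -
    have "T k g \<in> nonneg_alpha" for k
      using J(1) nonneg_alpha_0 by (auto simp: T_def)
    moreover have "c \<in> nonneg_alpha"
      unfolding c_def by (intro nonneg_alpha_add nonneg_alpha_mult nonneg_alpha_alpha nonneg_alpha_of_nat)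
    ultimately show ?thesis
      unfolding J'_def by (intro nonneg_alpha_add nonneg_alpha_mult nonneg_alpha_sum) auto
  qed
  ultimately show ?case by blast
qed

end

section \<open>Uniqueness of interpolation polynomials\<close>

definition mono_at :: "(nat \<Rightarrow> 'a::comm_semiring_1) \<Rightarrow> expo \<Rightarrow> 'a" where
  "mono_at v m = (\<Prod>i\<in>Poly_Mapping.keys m. v i ^ Poly_Mapping.lookup m i)"

lemma mono_at_superset:
  assumes "finite S" "Poly_Mapping.keys m \<subseteq> S"
  shows "mono_at v m = (\<Prod>i\<in>S. v i ^ Poly_Mapping.lookup m i)"
  unfolding mono_at_def using assms by (intro prod.mono_neutral_left) (auto simp: in_keys_iff)

lemma mono_at_add: "mono_at v (m + m') = mono_at v m * mono_at v m'"
proof -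
  let ?S = "Poly_Mapping.keys m \<union> Poly_Mapping.keys m'"
  have "Poly_Mapping.keys (m + m') \<subseteq> ?S" by (rule Poly_Mapping.keys_add)
  then show ?thesis
    by (simp add: mono_at_superset[of ?S] lookup_add power_add prod.distrib)
qed

lemma weight_superset:
  assumes "finite S" "Poly_Mapping.keys m \<subseteq> S"
  shows "weight m = (\<Sum>i\<in>S. Poly_Mapping.lookup m i)"
  unfolding weight_def using assms by (intro sum.mono_neutral_left) (auto simp: in_keys_iff)

lemma weight_add: "weight (m + m') = weight m + weight m'"
proof -
  let ?S = "Poly_Mapping.keys m \<union> Poly_Mapping.keys m'"
  have "Poly_Mapping.keys (m + m') \<subseteq> ?S" by (rule Poly_Mapping.keys_add)
  then show ?thesis
    by (simp add: weight_superset[of ?S] lookup_add sum.distrib)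
qed

lemma weight_single: "weight (Poly_Mapping.single i k) = k"
  by (simp add: weight_def)

lemma eval_at_superset:
  assumes "finite S" "Poly_Mapping.keys p \<subseteq> S"
  shows "eval_at v p = (\<Sum>m\<in>S. Poly_Mapping.lookup p m * mono_at v m)"
  unfolding eval_at_def subst_vars_def mono_at_def id_apply
  using assms by (intro sum.mono_neutral_left) (auto simp: in_keys_iff)

lemma eval_at_add: "eval_at v (p + q) = eval_at v p + eval_at v q"
proof -
  let ?S = "Poly_Mapping.keys p \<union> Poly_Mapping.keys q"
  have "Poly_Mapping.keys (p + q) \<subseteq> ?S" by (rule Poly_Mapping.keys_add)
  then show ?thesis
    by (simp add: eval_at_superset[of ?S] lookup_add sum.distrib distrib_right)
qed

lemma eval_at_0 [simp]: "eval_at v 0 = 0"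
  by (simp add: eval_at_def subst_vars_def)

lemma eval_at_sum: "eval_at v (\<Sum>x\<in>A. f x) = (\<Sum>x\<in>A. eval_at v (f x))"
  by (induction A rule: infinite_finite_induct) (simp_all add: eval_at_add)

lemma eval_at_single: "eval_at v (Poly_Mapping.single m c) = c * mono_at v m"
  by (simp add: eval_at_superset[of "{m}"])

lemma poly_mapping_sum_single: "p = (\<Sum>m\<in>Poly_Mapping.keys p. Poly_Mapping.single m (Poly_Mapping.lookup p m))"
  by (rule poly_mapping_eqI) (auto simp: lookup_sum lookup_single when_def sum.delta in_keys_iff)

lemma eval_at_mult: "eval_at v (p * q) = eval_at v p * eval_at v q"
proof -
  have "p * q = (\<Sum>m\<in>Poly_Mapping.keys p. \<Sum>m'\<in>Poly_Mapping.keys q.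
      Poly_Mapping.single (m + m') (Poly_Mapping.lookup p m * Poly_Mapping.lookup q m'))"
    by (subst (1) poly_mapping_sum_single[of p], subst (1) poly_mapping_sum_single[of q])
      (simp add: sum_product mult_single)
  then have "eval_at v (p * q) = (\<Sum>m\<in>Poly_Mapping.keys p. \<Sum>m'\<in>Poly_Mapping.keys q.
      (Poly_Mapping.lookup p m * mono_at v m) * (Poly_Mapping.lookup q m' * mono_at v m'))"
    by (simp add: eval_at_sum eval_at_single mono_at_add mult_ac)
  also have "\<dots> = eval_at v p * eval_at v q"
    by (simp add: eval_at_superset[of "Poly_Mapping.keys p" p] eval_at_superset[of "Poly_Mapping.keys q" q] sum_product)
  finally show ?thesis .
qed

lemma eval_at_mconst: "eval_at v (mconst c) = c"
  by (simp add: mconst_def eval_at_single mono_at_def)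

lemma eval_at_mvar: "eval_at v (mvar i) = v i"
  by (simp add: mvar_def eval_at_single mono_at_def)

lemma eval_at_diff: "eval_at v (p - q) = eval_at v p - (eval_at v q :: 'a::comm_ring_1)"
  using eval_at_add[of v "p - q" q] by simp

lemma eval_at_cong:
  assumes "\<And>m i. m \<in> Poly_Mapping.keys p \<Longrightarrow> i \<in> Poly_Mapping.keys m \<Longrightarrow> v i = w i"
  shows "eval_at v p = eval_at w p"
  unfolding eval_at_def subst_vars_def
  by (intro sum.cong refl arg_cong2[of _ _ _ _ "(*)"] prod.cong) (simp add: assms)

section \<open>Polynomials of bounded degree and division by a linear factor\<close>

definition polys_below :: "nat set \<Rightarrow> nat \<Rightarrow> Qr mpoly set" where
  "polys_below V d = {p. \<forall>m\<in>Poly_Mapping.keys p. Poly_Mapping.keys m \<subseteq> V \<and> weight m < d}"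

lemma polys_below_0: "0 \<in> polys_below V d"
  by (simp add: polys_below_def)

lemma polys_below_zero: "p \<in> polys_below V 0 \<Longrightarrow> p = 0"
  by (simp add: polys_below_def)

lemma polys_below_add: "p \<in> polys_below V d \<Longrightarrow> q \<in> polys_below V d \<Longrightarrow> p + q \<in> polys_below V d"
  using Poly_Mapping.keys_add[of p q] by (auto simp: polys_below_def)

lemma polys_below_sum: "(\<And>x. x \<in> A \<Longrightarrow> f x \<in> polys_below V d) \<Longrightarrow> sum f A \<in> polys_below V d"
  by (induction A rule: infinite_finite_induct) (auto intro: polys_below_0 polys_below_add)

lemma polys_below_mono: "p \<in> polys_below V d \<Longrightarrow> V \<subseteq> W \<Longrightarrow> d \<le> c \<Longrightarrow> p \<in> polys_below W c"
  by (force simp: polys_below_def)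

lemma polys_below_mconst:
  assumes "p \<in> polys_below V d"
  shows "mconst c * p \<in> polys_below V d"
proof -
  have "Poly_Mapping.keys (mconst c * p) \<subseteq> Poly_Mapping.keys p"
    using keys_mult[of "mconst c" p] by (auto simp: mconst_def split: if_splits)
  then show ?thesis using assms by (auto simp: polys_below_def)
qed

lemma polys_below_mvar:
  assumes "p \<in> polys_below V d" "a \<in> V"
  shows "mvar a * p \<in> polys_below V (Suc d)"
proof -
  have "Poly_Mapping.keys (mvar a * p) \<subseteq> {Poly_Mapping.single a 1 + m | m. m \<in> Poly_Mapping.keys p}"
    using keys_mult[of "mvar a" p] by (auto simp: mvar_def)
  moreover have "Poly_Mapping.keys (Poly_Mapping.single a 1 + m) \<subseteq> V \<and> weight (Poly_Mapping.single a 1 + m) < Suc d"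
    if "m \<in> Poly_Mapping.keys p" for m
    using assms that Poly_Mapping.keys_add[of "Poly_Mapping.single a 1" m]
    by (auto simp: polys_below_def weight_add weight_single)
  ultimately show ?thesis by (auto simp: polys_below_def)
qed

text \<open>Induction on the exponent of \<open>x_a\<close>: if \<open>M = g + (x_a - c) q\<close>,
  then \<open>x_a M = c g + (x_a - c) (g + x_a q)\<close>. The remainder stays free of
  \<open>x_a\<close>.\<close>

lemma divide_linear_single:
  assumes "Poly_Mapping.keys m \<subseteq> V" "weight m < d" "a \<in> V"
  shows "\<exists>g\<in>polys_below (V - {a}) d. \<exists>q\<in>polys_below V (d - 1).
    Poly_Mapping.single m k = g + (mvar a - mconst c) * q"
  using assms(1,2)
proof (induction "Poly_Mapping.lookup m a" arbitrary: m d)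
  case 0
  then have "a \<notin> Poly_Mapping.keys m" by (simp add: in_keys_iff)
  then have "Poly_Mapping.single m k \<in> polys_below (V - {a}) d"
    using 0 by (auto simp: polys_below_def)
  then show ?case
    using polys_below_0 by (intro bexI[of _ "Poly_Mapping.single m k"] bexI[of _ 0]) auto
next
  case (Suc b)
  define m' where "m' = m - Poly_Mapping.single a 1"
  have m: "m = Poly_Mapping.single a 1 + m'"
    using Suc.hyps(2) unfolding m'_def
    by (intro poly_mapping_eqI) (auto simp: lookup_add lookup_minus lookup_single when_def)
  have la: "b = Poly_Mapping.lookup m' a"
    using Suc.hyps(2) by (simp add: m'_def lookup_minus)
  have km: "Poly_Mapping.keys m' \<subseteq> V"
  proof
    fix i assume "i \<in> Poly_Mapping.keys m'"
    then have "i \<in> Poly_Mapping.keys m" by (auto simp: m lookup_add in_keys_iff)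
    then show "i \<in> V" using Suc.prems by blast
  qed
  have wm: "weight m = Suc (weight m')"
    by (simp add: m weight_add weight_single)
  have "weight m' < d - 1" using wm Suc.prems by simp
  from Suc.hyps(1)[OF la km this] obtain g q where
    g: "g \<in> polys_below (V - {a}) (d - 1)" and q: "q \<in> polys_below V (d - 1 - 1)"
    and eq: "Poly_Mapping.single m' k = g + (mvar a - mconst c) * q"
    by blast
  have "Poly_Mapping.single m k = mvar a * Poly_Mapping.single m' k"
    by (simp add: m mvar_def mult_single)
  also have "\<dots> = mconst c * g + (mvar a - mconst c) * (g + mvar a * q)"
    unfolding eq by (simp add: algebra_simps)
  finally have "Poly_Mapping.single m k = mconst c * g + (mvar a - mconst c) * (g + mvar a * q)" .
  moreover have "mconst c * g \<in> polys_below (V - {a}) d"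
    using polys_below_mono[OF polys_below_mconst[OF g]] by simp
  moreover have "g + mvar a * q \<in> polys_below V (d - 1)"
  proof (rule polys_below_add)
    show "g \<in> polys_below V (d - 1)" using polys_below_mono[OF g] by simp
    \<comment> \<open>The truncated subtraction is harmless: m has positive weight below d, so d is
      at least 2.\<close>
    have "Suc (d - 1 - 1) = d - 1" using wm Suc.prems by simp
    then show "mvar a * q \<in> polys_below V (d - 1)"
      using polys_below_mvar[OF q assms(3)] by simp
  qed
  ultimately show ?case by blast
qed

lemma divide_linear:
  assumes "p \<in> polys_below V d" "a \<in> V"
  obtains g q where "g \<in> polys_below (V - {a}) d" "q \<in> polys_below V (d - 1)"
    "p = g + (mvar a - mconst c) * q"
proof -
  have "\<forall>m\<in>Poly_Mapping.keys p. \<exists>g q. g \<in> polys_below (V - {a}) d \<and> q \<in> polys_below V (d - 1) \<and>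
    Poly_Mapping.single m (Poly_Mapping.lookup p m) = g + (mvar a - mconst c) * q"
    using divide_linear_single[OF _ _ assms(2), of _ d _ c] assms(1) by (auto simp: polys_below_def)
  then obtain G Q where GQ: "\<And>m. m \<in> Poly_Mapping.keys p \<Longrightarrow> G m \<in> polys_below (V - {a}) d"
    "\<And>m. m \<in> Poly_Mapping.keys p \<Longrightarrow> Q m \<in> polys_below V (d - 1)"
    "\<And>m. m \<in> Poly_Mapping.keys p \<Longrightarrow>
      Poly_Mapping.single m (Poly_Mapping.lookup p m) = G m + (mvar a - mconst c) * Q m"
    by metis
  have "p = (\<Sum>m\<in>Poly_Mapping.keys p. G m + (mvar a - mconst c) * Q m)"
    by (subst poly_mapping_sum_single) (intro sum.cong refl GQ(3))
  then have "p = sum G (Poly_Mapping.keys p) + (mvar a - mconst c) * sum Q (Poly_Mapping.keys p)"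
    by (simp only: sum.distrib sum_distrib_left)
  then show ?thesis
    using that[of "sum G (Poly_Mapping.keys p)" "sum Q (Poly_Mapping.keys p)"] GQ(1,2) by (simp add: polys_below_sum)
qed

section \<open>A polynomial is determined by its values at the interpolation points\<close>

context interpolation_dim
begin

text \<open>The interpolation point of e, written with ranks in place of the sorting permutation;
  \<open>shifted_target\<close> identifies the two.\<close>

definition target :: "(nat \<Rightarrow> nat) \<Rightarrow> nat \<Rightarrow> Qr" where
  "target e i = of_nat (e i) + r_indet * (of_nat n - of_nat (rnk n e i))"

text \<open>
  Splitting off the last variable leads to points whose coordinates are permuted and shifted, so
  the statement is proved for all bijective labelings \<open>\<tau>\<close> of the variables and all shifts \<open>c\<close>.
\<close>

lemma vanishing_aux:
  assumes "m \<le> n" "bij_betw \<tau> {1..m} V" "p \<in> polys_below V d"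
    "\<And>e y. (\<And>i. i \<notin> {1..m} \<Longrightarrow> e i = 0) \<Longrightarrow> wt e < d \<Longrightarrow>
      (\<And>i. i \<in> {1..m} \<Longrightarrow> y (\<tau> i) = target e i + of_nat (c i)) \<Longrightarrow> eval_at y p = 0"
  shows "p = 0"
  using assms
proof (induction m arbitrary: d V \<tau> c p)
  case 0
  have "m = 0" if "m \<in> Poly_Mapping.keys p" for m
    using 0(2,3) that by (auto simp: polys_below_def bij_betw_def)
  then have keys: "Poly_Mapping.keys p \<subseteq> {0}" by auto
  then have eval: "eval_at y p = Poly_Mapping.lookup p 0" for y
    by (simp add: eval_at_superset[of "{0}"] mono_at_def)
  show ?case
  proof (cases "d = 0")
    case True
    then show ?thesis using 0(3) polys_below_zero by simp
  next
    case False
    then have "Poly_Mapping.lookup p 0 = 0"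
      using 0(4)[of "\<lambda>i. 0" "\<lambda>i. 0"] by (simp add: eval wt_def)
    then have "0 \<notin> Poly_Mapping.keys p" by (simp add: in_keys_iff)
    then have "Poly_Mapping.keys p = {}" using keys by blast
    then show ?thesis by simp
  qed
next
  case (Suc m)
  note outer = Suc.IH
  from Suc.prems show ?case
  proof (induction d arbitrary: V \<tau> c p)
    case 0
    then show ?case using polys_below_zero by simp
  next
    case (Suc d)
    let ?M = "Suc m"
    define a where "a = \<tau> ?M"
    \<comment> \<open>The value of the last coordinate whenever the last entry is zero, as that
      entry then has rank \<open>Suc m\<close>.\<close>
    define c0 where "c0 = r_indet * (of_nat n - of_nat ?M) + of_nat (c ?M)"
    have a: "a \<in> V"
      using Suc.prems(2) by (auto simp: a_def bij_betw_def)
    obtain g q where g: "g \<in> polys_below (V - {a}) (Suc d)" and q: "q \<in> polys_below V d"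
      and p: "p = g + (mvar a - mconst c0) * q"
      using divide_linear[OF Suc.prems(3) a, of c0] by auto
    have eval_p: "eval_at y p = eval_at y g + (y a - c0) * eval_at y q" for y
      by (simp add: p eval_at_add eval_at_mult eval_at_diff eval_at_mvar eval_at_mconst)
    have inj: "inj_on \<tau> {1..?M}" and img: "\<tau> ` {1..?M} = V"
      using Suc.prems(2) by (auto simp: bij_betw_def)
    \<comment> \<open>Where the last coordinate equals \<open>c0\<close>, the linear factor vanishes
      and p agrees with g, which does not involve that variable.\<close>
    have "g = 0"
    proof (rule outer[of \<tau> "V - {a}" g "Suc d" c])
      show "m \<le> n" using Suc.prems(1) by simp
      have "{1..?M} - {?M} = {1..m}" by auto
      moreover have "\<tau> ` ({1..?M} - {?M}) = \<tau> ` {1..?M} - \<tau> ` {?M}"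
        using inj by (intro inj_on_image_set_diff) auto
      ultimately have "\<tau> ` {1..m} = V - {a}"
        using img by (simp add: a_def)
      moreover have "inj_on \<tau> {1..m}" using inj by (rule inj_on_subset) auto
      ultimately show "bij_betw \<tau> {1..m} (V - {a})" by (simp add: bij_betw_def)
      show "g \<in> polys_below (V - {a}) (Suc d)" by (rule g)
    next
      fix e y assume e: "\<And>i. i \<notin> {1..m} \<Longrightarrow> e i = 0" "wt e < Suc d"
        "\<And>i. i \<in> {1..m} \<Longrightarrow> y (\<tau> i) = target e i + of_nat (c i)"
      let ?y = "y(a := c0)"
      have "rnk n e ?M = ?M"
        using Suc.prems(1) by (intro rnk_zero) (auto intro: e(1))
      then have top: "target e ?M + of_nat (c ?M) = c0"
        using e(1)[of ?M] by (simp add: target_def c0_def)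
      have "eval_at ?y p = 0"
      proof (rule Suc.prems(4)[of e])
        fix i assume i: "i \<in> {1..?M}"
        show "?y (\<tau> i) = target e i + of_nat (c i)"
        proof (cases "i = ?M")
          case True
          then show ?thesis using top by (simp add: a_def)
        next
          case False
          then have "\<tau> i \<noteq> a"
            using inj_onD[OF inj, of i ?M] i by (auto simp: a_def)
          then show ?thesis using e(3)[of i] i False by simp
        qed
      qed (use e in auto)
      then have "eval_at ?y g = 0" by (simp add: eval_p)
      moreover have "eval_at ?y g = eval_at y g"
        using g by (intro eval_at_cong) (auto simp: polys_below_def)
      ultimately show "eval_at y g = 0" by simp
    qed
    have M: "?M \<in> {1..n}" using Suc.prems(1) by simp
    \<comment> \<open>Here compositions with positive last entry are used, written as
      \<open>shift (Suc m) e\<close>. Their points are those of e, rotated by \<open>cyc\<close> and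
      with one coordinate raised by 1; the new labeling and shift absorb this.\<close>
    have "q = 0"
    proof (rule Suc.IH[of "\<tau> \<circ> cyc ?M" V q "\<lambda>i. c (cyc ?M i) + (if i = 1 then 1 else 0)"])
      show "?M \<le> n" by (rule Suc.prems(1))
      show "bij_betw (\<tau> \<circ> cyc ?M) {1..?M} V"
        using bij_betw_cyc[of ?M ?M] Suc.prems(2) by (auto intro: bij_betw_trans)
      show "q \<in> polys_below V d" by (rule q)
    next
      fix e y assume e: "\<And>i. i \<notin> {1..?M} \<Longrightarrow> e i = 0" "wt e < d"
        "\<And>i. i \<in> {1..?M} \<Longrightarrow> y ((\<tau> \<circ> cyc ?M) i) = target e i + of_nat (c (cyc ?M i) + (if i = 1 then 1 else 0))"
      define e' where "e' = shift ?M e"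
      have e'0: "e' i = 0" if "i \<notin> {1..?M}" for i
        using that e(1)[of i] by (auto simp: e'_def shift_def)
      have e'M: "0 < e' ?M" by (simp add: e'_def shift_def)
      have un: "unshift ?M e' = e" by (simp add: e'_def unshift_shift)
      have "Suc (wt e) = wt e'"
        using wt_unshift[of ?M e'] M e'M un by simp
      moreover have "y (\<tau> i) = target e' i + of_nat (c i)" if i: "i \<in> {1..?M}" for i
      proof -
        have "i \<in> cyc ?M ` {1..?M}"
          using bij_betw_imp_surj_on[OF bij_betw_cyc[of ?M ?M]] i by simp
        then obtain k where k: "k \<in> {1..?M}" "i = cyc ?M k" by blast
        have "rnk n (unshift ?M e') k = rnk n e' (cyc ?M k)"
          using e'M M by (intro rnk_unshift) (auto intro: e'0)
        then have rk: "rnk n e k = rnk n e' i" using un k(2) by simp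
        have "of_nat (e k) + (if k = 1 then 1 else 0) = (of_nat (e' i) :: Qr)"
          using k by (auto simp: e'_def shift_def cyc_def)
        then show ?thesis
          using e(3)[OF k(1)] k(2) rk by (auto simp: target_def algebra_simps)
      qed
      ultimately have "eval_at y p = 0"
        using e'0 e(2) by (intro Suc.prems(4)[of e']) auto
      then have "(y a - c0) * eval_at y q = 0"
        using \<open>g = 0\<close> by (simp add: eval_p)
      \<comment> \<open>It equals \<open>e' (Suc m)\<close> plus r times an integer; multiplied by
        alpha, the positive entry becomes the coefficient of alpha.\<close>
      moreover have "y a - c0 \<noteq> 0"
      proof
        assume "y a - c0 = 0"
        moreover have "y a = target e' ?M + of_nat (c ?M)"
          unfolding a_def using \<open>\<And>i. i \<in> {1..?M} \<Longrightarrow> y (\<tau> i) = target e' i + of_nat (c i)\<close>[of ?M] by simp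
        ultimately have "of_nat (e' ?M) + r_indet * (of_nat ?M - of_nat (rnk n e' ?M)) = 0"
          by (simp add: target_def c0_def algebra_simps)
        then have "alpha * (of_nat (e' ?M) + r_indet * (of_nat ?M - of_nat (rnk n e' ?M))) = 0"
          by simp
        moreover have "alpha * r_indet = 1"
          using alpha_nonzero by (auto simp: alpha_def)
        ultimately have "of_int (int ?M - int (rnk n e' ?M)) + of_int (int (e' ?M)) * alpha = 0"
          by (simp add: algebra_simps flip: mult.assoc)
        then show False
          using of_int_alpha_independent e'M by fastforce
      qed
      ultimately show "eval_at y q = 0" by simp
    qed
    then show ?case using p \<open>g = 0\<close> by simp
  qed
qed

lemma vanishing:
  assumes "p \<in> polys_below {1..n} d" "\<And>e. e \<in> comps \<Longrightarrow> wt e < d \<Longrightarrow> eval_at (target e) p = 0"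
  shows "p = 0"
proof (rule vanishing_aux[of n id "{1..n}" p d "\<lambda>i. 0"])
  fix e y assume e: "\<And>i. i \<notin> {1..n} \<Longrightarrow> e i = 0" "wt e < d"
    and y: "\<And>i. i \<in> {1..n} \<Longrightarrow> y (id i) = target e i + of_nat 0"
  have "eval_at (target e) p = 0"
    using e by (intro assms(2)) (auto simp: comps_def)
  moreover have "eval_at (target e) p = eval_at y p"
    using assms(1) y by (intro eval_at_cong) (force simp: polys_below_def)
  ultimately show "eval_at y p = 0" by simp
qed (use assms(1) in auto)

end

section \<open>The sorting permutation and the integral form\<close>

definition inversions :: "nat \<Rightarrow> (nat \<Rightarrow> nat) \<Rightarrow> (nat \<times> nat) set" where
  "inversions n s = {(a, b). a \<in> {1..n} \<and> b \<in> {1..n} \<and> a < b \<and> s b < s a}"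

lemma finite_inversions: "finite (inversions n s)"
  by (rule finite_subset[of _ "{1..n} \<times> {1..n}"]) (auto simp: inversions_def)

text \<open>Lengths are counted on inverses because the rank function is the inverse of the sorting
  permutation.\<close>

lemma perm_length_inversions:
  assumes "w permutes {1..n}"
  shows "perm_length n w = card (inversions n (inv w))"
proof -
  let ?A = "{(i, j). i \<in> {1..n} \<and> j \<in> {1..n} \<and> i < j \<and> w j < w i}"
  have win: "w i \<in> {1..n} \<longleftrightarrow> i \<in> {1..n}" "inv w i \<in> {1..n} \<longleftrightarrow> i \<in> {1..n}" for i
    using permutes_in_image[OF assms] permutes_in_image[OF permutes_inv[OF assms]] by auto
  have "bij_betw (\<lambda>(i, j). (w j, w i)) ?A (inversions n (inv w))"
    by (rule bij_betw_byWitness[where f' = "\<lambda>(a, b). (inv w b, inv w a)"])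
      (auto simp: inversions_def permutes_inverses[OF assms] win[unfolded One_nat_def] simp del: atLeastAtMost_iff)
  then show ?thesis
    unfolding perm_length_def by (rule bij_betw_same_card)
qed

lemma rnk_permutes: "rnk n e permutes {1..n}"
proof (rule bij_imp_permutes)
  have "inj_on (rnk n e) {1..n}" by (auto intro!: inj_onI simp: rnk_eq_iff)
  moreover have "rnk n e ` {1..n} \<subseteq> {1..n}" using rnk_bounds by blast
  ultimately show "bij_betw (rnk n e) {1..n} {1..n}"
    by (simp add: bij_betw_def endo_inj_surj)
qed (auto simp: rnk_def)

lemma permutes_eq_card:
  assumes "s permutes {1..n}" "i \<in> {1..n}"
  shows "card {k \<in> {1..n}. s k \<le> s i} = s i"
proof -
  have "s i \<in> {1..n}" using permutes_in_image[OF assms(1)] assms(2) by blast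
  have "s ` {1..n} = {1..n}" using assms(1) by (rule permutes_image)
  have "s ` {k \<in> {1..n}. s k \<le> s i} = {y \<in> s ` {1..n}. y \<le> s i}" by blast
  also have "\<dots> = {1..s i}"
    using \<open>s ` {1..n} = {1..n}\<close> \<open>s i \<in> {1..n}\<close> by auto
  finally have "s ` {k \<in> {1..n}. s k \<le> s i} = {1..s i}" .
  moreover have "inj_on s {k \<in> {1..n}. s k \<le> s i}"
    using permutes_inj[OF assms(1)] by (rule inj_on_subset) simp
  ultimately show ?thesis by (metis card_atLeastAtMost card_image diff_Suc_1)
qed

text \<open>The inverse of any sorting permutation inverts every pair in \<open>F\<close>, and
  \<open>rnk\<close> inverts no other pair. Minimal length thus forces the inversion set to be
  \<open>F\<close>, and a permutation is determined by its inversions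
  (\<open>permutes_eq_card\<close>).\<close>

lemma inv_sorting_perm:
  assumes "i \<in> {1..n}"
  shows "inv (sorting_perm n \<gamma>) i = rnk n (Poly_Mapping.lookup \<gamma>) i"
proof -
  define e where "e = Poly_Mapping.lookup \<gamma>"
  define P where "P w \<longleftrightarrow> w permutes {1..n} \<and> weakly_decreasing n (perm_act (inv w) e)" for w
  define F where "F = {(a, b). a \<in> {1..n} \<and> b \<in> {1..n} \<and> a < b \<and> e a < e b}"
  define w where "w = sorting_perm n \<gamma>"
  have act: "perm_act (inv w) e i = e (w i)" if "w permutes {1..n}" for w i
    using that by (simp add: perm_act_def permutes_inv_inv)
  define w0 where "w0 = inv (rnk n e)"
  have w0: "w0 permutes {1..n}" "inv w0 = rnk n e"
    unfolding w0_def using permutes_inv[OF rnk_permutes] permutes_inv_inv[OF rnk_permutes] by blast+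
  have "P w0" unfolding P_def weakly_decreasing_def
  proof (intro conjI ballI impI)
    show "w0 permutes {1..n}" by (rule w0)
    fix i j assume ij: "i \<in> {1..n}" "j \<in> {1..n}" "i \<le> j"
    have r: "rnk n e (w0 i) = i" for i
      using permutes_inverses(1)[OF rnk_permutes] by (simp add: w0_def)
    have w0_in: "w0 i \<in> {1..n}" "w0 j \<in> {1..n}"
      using ij permutes_in_image[OF w0(1)] by auto
    show "perm_act (inv w0) e j \<le> perm_act (inv w0) e i"
    proof (rule ccontr)
      assume "\<not> perm_act (inv w0) e j \<le> perm_act (inv w0) e i"
      then have lt: "e (w0 i) < e (w0 j)" by (simp add: act[OF w0(1)])
      then have "rnk n e (w0 j) < rnk n e (w0 i)"
        using w0_in by (intro rnk_less) (auto simp: before_def)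
      with r ij show False by simp
    qed
  qed
  have "sorting_perm n \<gamma> = arg_min (perm_length n) P"
    unfolding sorting_perm_def P_def e_def ..
  then have Pw: "P w" and min: "perm_length n w \<le> perm_length n w0"
    using arg_min_nat_lemma[of P w0 "perm_length n"] \<open>P w0\<close> by (simp_all add: w_def)
  have w: "w permutes {1..n}" using Pw by (simp add: P_def)
  have F_sub: "F \<subseteq> inversions n (inv w)"
  proof
    fix x assume "x \<in> F"
    then obtain a b where ab: "x = (a, b)" "a \<in> {1..n}" "b \<in> {1..n}" "a < b" "e a < e b"
      by (auto simp: F_def)
    have "inv w b < inv w a"
    proof (rule ccontr)
      assume "\<not> inv w b < inv w a"
      then have "e (w (inv w b)) \<le> e (w (inv w a))"
        using Pw permutes_in_image[OF permutes_inv[OF w]] ab act[OF w]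
        by (auto simp: P_def weakly_decreasing_def)
      with ab show False by (simp add: permutes_inverses[OF w])
    qed
    then show "x \<in> inversions n (inv w)" using ab by (simp add: inversions_def)
  qed
  have "inversions n (inv w0) \<subseteq> F"
  proof
    fix x assume "x \<in> inversions n (inv w0)"
    then obtain a b where ab: "x = (a, b)" "a \<in> {1..n}" "b \<in> {1..n}" "a < b" "rnk n e b < rnk n e a"
      by (auto simp: inversions_def w0)
    then have "\<not> before e a b"
      using rnk_less[of a n b e] by auto
    then show "x \<in> F" using ab by (auto simp: F_def before_def)
  qed
  then have "card (inversions n (inv w0)) \<le> card F"
    using finite_subset[OF F_sub finite_inversions] by (intro card_mono)
  then have "card (inversions n (inv w)) \<le> card F"
    using min perm_length_inversions[OF w] perm_length_inversions[OF w0(1)] by linarith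
  then have inv_F: "inversions n (inv w) = F"
    using F_sub finite_inversions[of n "inv w"] by (metis card_seteq)
  have "inv w k \<le> inv w i \<longleftrightarrow> before e k i" if k: "k \<in> {1..n}" for k
  proof (cases k i rule: linorder_cases)
    case equal
    then show ?thesis by (simp add: before_def)
  next
    case less
    then have "(k, i) \<in> inversions n (inv w) \<longleftrightarrow> (k, i) \<in> F" by (simp add: inv_F)
    then show ?thesis using less k assms by (auto simp: inversions_def F_def before_def)
  next
    case greater
    have "inv w k \<noteq> inv w i"
      using greater permutes_inj[OF permutes_inv[OF w]] by (auto dest: injD)
    moreover have "(i, k) \<in> inversions n (inv w) \<longleftrightarrow> (i, k) \<in> F" by (simp add: inv_F)
    ultimately show ?thesis using greater k assms by (auto simp: inversions_def F_def before_def)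
  qed
  then have "{k \<in> {1..n}. inv w k \<le> inv w i} = {k \<in> {1..n}. before e k i}" by blast
  then have "inv w i = card {k \<in> {1..n}. before e k i}"
    using permutes_eq_card[OF permutes_inv[OF w] assms] by simp
  then show ?thesis
    using assms by (simp add: rnk_def w_def e_def)
qed

section \<open>Hook products and coefficients under substitution\<close>

lemma hook_product_hooks: "hook_product n \<eta> alpha = hooks n (Poly_Mapping.lookup \<eta>)"
proof -
  let ?e = "Poly_Mapping.lookup \<eta>"
  have "leg n \<eta> (i, j) = legs n ?e i j" for i j
  proof -
    have "{k \<in> {1..n}. (i < k \<and> j \<le> ?e k \<and> ?e k \<le> ?e i) \<or> (k < i \<and> j \<le> ?e k + 1 \<and> ?e k + 1 \<le> ?e i)}
      = {k \<in> {1..n}. k > i \<and> j \<le> ?e k \<and> ?e k \<le> ?e i} \<union> {k \<in> {1..n}. k < i \<and> j \<le> ?e k + 1 \<and> ?e k + 1 \<le> ?e i}"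
      by auto
    moreover have "card ({k \<in> {1..n}. k > i \<and> j \<le> ?e k \<and> ?e k \<le> ?e i} \<union> {k \<in> {1..n}. k < i \<and> j \<le> ?e k + 1 \<and> ?e k + 1 \<le> ?e i})
      = card {k \<in> {1..n}. k > i \<and> j \<le> ?e k \<and> ?e k \<le> ?e i} + card {k \<in> {1..n}. k < i \<and> j \<le> ?e k + 1 \<and> ?e k + 1 \<le> ?e i}"
      by (intro card_Un_disjoint) auto
    ultimately show ?thesis by (simp only: leg_def legs_def prod.case)
  qed
  moreover have "boxes n \<eta> = Sigma {1..n} (\<lambda>i. {1..?e i})"
    by (auto simp: boxes_def)
  ultimately show ?thesis
    unfolding hook_product_def hooks_def hook_def
    by (subst prod.Sigma) (auto intro!: prod.cong simp: arm_def)
qed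

lemma hooks_nonzero: "hooks n e \<noteq> 0"
proof -
  have "hook n e i j \<noteq> 0" for i j
  proof
    assume "hook n e i j = 0"
    then have "of_int (int (legs n e i j) + 1) + of_int (int (e i - j) + 1) * alpha = 0"
      by (simp add: hook_def algebra_simps)
    then show False using of_int_alpha_independent by fastforce
  qed
  then show ?thesis by (simp add: hooks_def)
qed

lemma lookup_mconst_mult: "Poly_Mapping.lookup (mconst c * p) m = c * Poly_Mapping.lookup p m"
proof -
  have "mconst c * p = (\<Sum>m\<in>Poly_Mapping.keys p. Poly_Mapping.single m (c * Poly_Mapping.lookup p m))"
    by (subst (1) poly_mapping_sum_single[of p]) (simp add: mconst_def sum_distrib_left mult_single)
  then show ?thesis
    by (auto simp: lookup_sum lookup_single when_def sum.delta in_keys_iff)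
qed

lemma lookup_negate_vars: "Poly_Mapping.lookup (negate_vars p) m = (- 1) ^ weight m * Poly_Mapping.lookup p m"
proof -
  have pow: "(- mvar i :: 'a mpoly) ^ k = Poly_Mapping.single (Poly_Mapping.single i k) ((- 1) ^ k)" for i k
  proof (induction k)
    case (Suc k)
    have "(- mvar i :: 'a mpoly) = Poly_Mapping.single (Poly_Mapping.single i 1) (- 1)"
      by (simp add: mvar_def single_uminus)
    then show ?case using Suc by (simp add: mult_single flip: single_add)
  qed simp
  have prod: "(\<Prod>i\<in>S. (- mvar i :: 'a mpoly) ^ Poly_Mapping.lookup m i)
      = Poly_Mapping.single (\<Sum>i\<in>S. Poly_Mapping.single i (Poly_Mapping.lookup m i)) ((- 1) ^ (\<Sum>i\<in>S. Poly_Mapping.lookup m i))"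
    if "finite S" for S m
    using that by (induction S rule: finite_induct) (simp_all add: pow mult_single power_add)
  have mono: "(\<Prod>i\<in>Poly_Mapping.keys m. (- mvar i :: 'a mpoly) ^ Poly_Mapping.lookup m i)
      = Poly_Mapping.single m ((- 1) ^ weight m)" for m
    by (simp add: prod weight_def flip: poly_mapping_sum_single)
  have "negate_vars p = (\<Sum>m\<in>Poly_Mapping.keys p. Poly_Mapping.single m ((- 1) ^ weight m * Poly_Mapping.lookup p m))"
    unfolding negate_vars_def subst_vars_def mono
    by (intro sum.cong) (simp_all add: mconst_def mult_single mult.commute)
  then show ?thesis
    by (auto simp: lookup_sum lookup_single when_def sum.delta in_keys_iff)
qed

text \<open>The polynomial \<open>p(a x) / c\<close>.\<close>

definition rescale :: "Qr \<Rightarrow> Qr \<Rightarrow> Qr mpoly \<Rightarrow> Qr mpoly" where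
  "rescale a c p = Poly_Mapping.mapp (\<lambda>m b. a ^ weight m * b / c) p"

lemma lookup_rescale: "Poly_Mapping.lookup (rescale a c p) m = a ^ weight m * Poly_Mapping.lookup p m / c"
  by (auto simp: rescale_def lookup_mapp when_def in_keys_iff)

lemma eval_at_rescale: "eval_at v (rescale a c p) = eval_at (\<lambda>i. a * v i) p / c"
proof -
  have "mono_at (\<lambda>i. a * v i) m = a ^ weight m * mono_at v m" for m
    by (simp add: mono_at_def weight_def power_mult_distrib prod.distrib power_sum)
  moreover have "Poly_Mapping.keys (rescale a c p) \<subseteq> Poly_Mapping.keys p"
    by (auto simp: in_keys_iff lookup_rescale)
  ultimately show ?thesis
    by (simp add: eval_at_superset[of "Poly_Mapping.keys p"] lookup_rescale sum_divide_distrib mult_ac)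
qed

section \<open>From functions on generic points to polynomials\<close>

context interpolation_dim
begin

definition expo_of :: "(nat \<Rightarrow> nat) \<Rightarrow> expo" where
  "expo_of e = Abs_poly_mapping (\<lambda>i. if i \<in> {1..n} then e i else 0)"

lemma lookup_expo_of: "Poly_Mapping.lookup (expo_of e) i = (if i \<in> {1..n} then e i else 0)"
proof -
  have "finite {i. (if i \<in> {1..n} then e i else 0) \<noteq> 0}"
    by (rule finite_subset[of _ "{1..n}"]) auto
  then show ?thesis by (simp add: expo_of_def)
qed

lemma keys_expo_of: "Poly_Mapping.keys (expo_of e) \<subseteq> {1..n}"
  by (auto simp: in_keys_iff lookup_expo_of split: if_splits)

lemma weight_expo_of: "weight (expo_of e) = wt e"
  using weight_superset[OF _ keys_expo_of, of e] by (simp add: lookup_expo_of wt_def)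

lemma mono_at_expo_of: "mono_at (coord v) (expo_of e) = monomial e v"
  using mono_at_superset[OF _ keys_expo_of, of "coord v" e] by (simp add: lookup_expo_of monomial_def)

lemma expo_of_lookup: "composition n \<eta> \<Longrightarrow> expo_of (Poly_Mapping.lookup \<eta>) = \<eta>"
  by (rule poly_mapping_eqI) (auto simp: lookup_expo_of composition_def in_keys_iff)

lemma lookup_comps: "composition n \<eta> \<Longrightarrow> Poly_Mapping.lookup \<eta> \<in> comps"
  by (auto simp: comps_def composition_def in_keys_iff)

lemma weight_wt: "composition n \<eta> \<Longrightarrow> weight \<eta> = wt (Poly_Mapping.lookup \<eta>)"
  using weight_expo_of[of "Poly_Mapping.lookup \<eta>"] by (simp add: expo_of_lookup)

lemma pos_below_poly:
  assumes "h \<in> pos_below d"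
  shows "\<exists>H\<in>polys_below {1..n} d. range (Poly_Mapping.lookup H) \<subseteq> nonneg_alpha \<and> (\<forall>v. eval_at (coord v) H = h v)"
  using assms
proof induction
  case zero
  then show ?case
    using polys_below_0 nonneg_alpha_0 by (intro bexI[of _ 0]) auto
next
  case (add_monomial c e f)
  then obtain H where H: "H \<in> polys_below {1..n} d" "range (Poly_Mapping.lookup H) \<subseteq> nonneg_alpha"
    "\<forall>v. eval_at (coord v) H = f v" by blast
  let ?H = "Poly_Mapping.single (expo_of e) c + H"
  have "?H \<in> polys_below {1..n} d"
    using H(1) keys_expo_of add_monomial.hyps(2)
    by (intro polys_below_add) (auto simp: polys_below_def weight_expo_of)
  moreover have "range (Poly_Mapping.lookup ?H) \<subseteq> nonneg_alpha"
    using H(2) add_monomial.hyps(1) nonneg_alpha_0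
    by (auto simp: lookup_add lookup_single when_def intro!: nonneg_alpha_add)
  moreover have "\<forall>v. eval_at (coord v) ?H = c * monomial e v + f v"
    using H(3) by (simp add: eval_at_add eval_at_single mono_at_expo_of)
  ultimately show ?case by blast
qed

text \<open>The B of the overview: its top degree part has the Jack coefficients \<open>J\<close>,
  and \<open>H\<close> collects the lower terms, that is, the combination of the
  \<open>Psi g - x^g\<close>. Hence the coefficient at \<open>\<eta>\<close> is \<open>J e\<close>,
  the hook product.\<close>

lemma integral_form:
  assumes "composition n \<eta>"
  shows "\<exists>B\<in>polys_below {1..n} (Suc (weight \<eta>)). range (Poly_Mapping.lookup B) \<subseteq> nonneg_alpha \<and>
    Poly_Mapping.lookup B \<eta> = hook_product n \<eta> alpha \<and>
    supported (weight \<eta>) {Poly_Mapping.lookup \<eta>} (\<lambda>v. eval_at (coord v) B)"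
proof -
  define e where "e = Poly_Mapping.lookup \<eta>"
  define d where "d = weight \<eta>"
  have e: "e \<in> comps" "wt e = d"
    using assms by (simp_all add: e_def d_def lookup_comps weight_wt)
  obtain J where J: "range J \<subseteq> nonneg_alpha" "J e = hooks n e"
    "supported d {e} (\<lambda>v. \<Sum>g\<in>comps_of d. J g * Psi g v)"
    using Jack_coefficients[OF e(1)] e(2) by auto
  have "(\<lambda>v. \<Sum>g\<in>comps_of d. J g * (Psi g v - monomial g v)) \<in> pos_below d"
  proof (rule pos_below_sum)
    fix g assume "g \<in> comps_of d"
    then have "(\<lambda>v. Psi g v - monomial g v) \<in> pos_below d"
      using Psi_positive[of g] by (simp add: comps_of_def)
    then show "(\<lambda>v. J g * (Psi g v - monomial g v)) \<in> pos_below d"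
      using J(1) by (intro pos_below_cmult) auto
  qed
  then obtain H where H: "H \<in> polys_below {1..n} d" "range (Poly_Mapping.lookup H) \<subseteq> nonneg_alpha"
    "\<forall>v. eval_at (coord v) H = (\<Sum>g\<in>comps_of d. J g * (Psi g v - monomial g v))"
    using pos_below_poly by blast
  define B where "B = (\<Sum>g\<in>comps_of d. Poly_Mapping.single (expo_of g) (J g)) + H"
  have B_below: "B \<in> polys_below {1..n} (Suc d)"
    unfolding B_def
  proof (intro polys_below_add polys_below_sum)
    show "H \<in> polys_below {1..n} (Suc d)"
      by (rule polys_below_mono[OF H(1)]) auto
    fix g assume "g \<in> comps_of d"
    then show "Poly_Mapping.single (expo_of g) (J g) \<in> polys_below {1..n} (Suc d)"
      using keys_expo_of by (auto simp: polys_below_def weight_expo_of comps_of_def)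
  qed
  have J_nonneg: "J g \<in> nonneg_alpha" for g
    using J(1) by auto
  have "Poly_Mapping.lookup B m \<in> nonneg_alpha" for m
    using H(2) J_nonneg nonneg_alpha_0
    by (auto simp: B_def lookup_add lookup_sum lookup_single when_def intro!: nonneg_alpha_add nonneg_alpha_sum)
  moreover note B_below
  moreover have "Poly_Mapping.lookup B \<eta> = hook_product n \<eta> alpha"
  proof -
    have "Poly_Mapping.lookup H \<eta> = 0"
      using H(1) by (auto simp: polys_below_def d_def in_keys_iff)
    moreover have "expo_of g = \<eta> \<longleftrightarrow> g = e" if "g \<in> comps_of d" for g
    proof -
      have "g = Poly_Mapping.lookup (expo_of g)"
        using that by (auto simp: fun_eq_iff lookup_expo_of comps_of_def comps_def)
      then show ?thesis
        using expo_of_lookup[OF assms] by (auto simp: e_def)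
    qed
    then have "(\<Sum>g\<in>comps_of d. Poly_Mapping.lookup (Poly_Mapping.single (expo_of g) (J g)) \<eta>)
        = (\<Sum>g\<in>comps_of d. if g = e then J g else 0)"
      by (intro sum.cong) (auto simp: lookup_single when_def)
    then have "(\<Sum>g\<in>comps_of d. Poly_Mapping.lookup (Poly_Mapping.single (expo_of g) (J g)) \<eta>) = J e"
      using e finite_comps_of by (simp add: comps_of_def)
    ultimately show ?thesis
      using J(2) by (simp add: B_def lookup_add lookup_sum hook_product_hooks e_def)
  qed
  moreover have "eval_at (coord v) B = (\<Sum>g\<in>comps_of d. J g * Psi g v)" for v
  proof -
    have "eval_at (coord v) B = (\<Sum>g\<in>comps_of d. J g * monomial g v) + (\<Sum>g\<in>comps_of d. J g * (Psi g v - monomial g v))"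
      using H(3) by (simp add: B_def eval_at_add eval_at_sum eval_at_single mono_at_expo_of)
    then show ?thesis by (simp add: right_diff_distrib sum_subtractf)
  qed
  ultimately show ?thesis
    using J(3) by (intro bexI[of _ B]) (auto simp: d_def e_def)
qed

section \<open>Identification of the interpolation polynomial\<close>

lemma shifted_target:
  assumes "i \<in> {1..n}"
  shows "shifted n \<gamma> i = target (Poly_Mapping.lookup \<gamma>) i"
proof -
  have "rnk n (Poly_Mapping.lookup \<gamma>) i \<le> n"
    using rnk_bounds[OF assms] by auto
  then show ?thesis
    using assms by (simp add: shifted_def target_def perm_act_def r_delta_def inv_sorting_perm of_nat_diff)
qed

lemma target_node: "- alpha * target e i = coord (node e) i"
proof -
  have "alpha * r_indet = 1"
    using alpha_nonzero by (auto simp: alpha_def)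
  then have r: "alpha * (r_indet * x) = x" for x
    by (simp flip: mult.assoc)
  show ?thesis
    by (simp add: target_def coord_node algebra_simps r)
qed

lemma eval_shifted: "p \<in> polys_below {1..n} d \<Longrightarrow> eval_at (shifted n \<gamma>) p = eval_at (target (Poly_Mapping.lookup \<gamma>)) p"
  unfolding polys_below_def by (intro eval_at_cong shifted_target) blast

lemma composition_expo_of: "composition n (expo_of e)"
  using keys_expo_of by (simp add: composition_def)

lemma lookup_expo_of_comps: "e \<in> comps \<Longrightarrow> Poly_Mapping.lookup (expo_of e) = e"
  by (auto simp: fun_eq_iff lookup_expo_of comps_def)

lemma vanishing_shifted:
  assumes "p \<in> polys_below {1..n} (Suc d)"
    "\<And>\<gamma>. composition n \<gamma> \<Longrightarrow> weight \<gamma> \<le> d \<Longrightarrow> eval_at (shifted n \<gamma>) p = 0"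
  shows "p = 0"
proof (rule vanishing[OF assms(1)])
  fix e assume "e \<in> comps" "wt e < Suc d"
  then show "eval_at (target e) p = 0"
    using assms(2)[of "expo_of e"] eval_shifted[OF assms(1), of "expo_of e"]
    by (simp add: composition_expo_of weight_expo_of lookup_expo_of_comps)
qed

text \<open>By \<open>vanishing_shifted\<close>, p is nonzero at the point of \<open>\<eta>\<close>.
  For a second candidate q, the multiple of p that cancels its value there gives a sum vanishing at
  all points, hence zero; comparing coefficients at \<open>\<eta>\<close> makes the factor
  -1.\<close>

lemma interp_E_eqI:
  assumes "composition n \<eta>" "p \<in> polys_below {1..n} (Suc (weight \<eta>))" "Poly_Mapping.lookup p \<eta> = 1"
    "\<And>\<gamma>. composition n \<gamma> \<Longrightarrow> \<gamma> \<noteq> \<eta> \<Longrightarrow> weight \<gamma> \<le> weight \<eta> \<Longrightarrow> eval_at (shifted n \<gamma>) p = 0"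
  shows "interp_E n \<eta> = p"
  unfolding interp_E_def
proof (rule the_equality)
  have "\<eta> \<in> Poly_Mapping.keys p" using assms(3) by (simp add: in_keys_iff)
  moreover have "\<And>m. m \<in> Poly_Mapping.keys p \<Longrightarrow> weight m \<le> weight \<eta>"
    using assms(2) by (auto simp: polys_below_def)
  ultimately have "total_degree p = weight \<eta>"
    unfolding total_degree_def by (intro Max_eqI) auto
  then show "p \<in> polys_in n \<and> total_degree p = weight \<eta> \<and>
      (\<forall>\<gamma>. composition n \<gamma> \<and> \<gamma> \<noteq> \<eta> \<and> weight \<gamma> \<le> weight \<eta> \<longrightarrow> eval_at (shifted n \<gamma>) p = 0) \<and>
      Poly_Mapping.lookup p \<eta> = 1"
    using assms by (auto simp: polys_in_def polys_below_def composition_def)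
next
  fix q assume q: "q \<in> polys_in n \<and> total_degree q = weight \<eta> \<and>
      (\<forall>\<gamma>. composition n \<gamma> \<and> \<gamma> \<noteq> \<eta> \<and> weight \<gamma> \<le> weight \<eta> \<longrightarrow> eval_at (shifted n \<gamma>) q = 0) \<and>
      Poly_Mapping.lookup q \<eta> = 1"
  have "weight m \<le> total_degree q" if "m \<in> Poly_Mapping.keys q" for m
    unfolding total_degree_def using that by (intro Max_ge) auto
  then have q_below: "q \<in> polys_below {1..n} (Suc (weight \<eta>))"
    using q by (auto simp: polys_in_def polys_below_def composition_def less_Suc_eq_le)
  define a where "a = eval_at (shifted n \<eta>) p"
  have a: "a \<noteq> 0"
  proof
    assume "a = 0"
    then have "p = 0"
      using assms(4) by (intro vanishing_shifted[OF assms(2)]) (metis a_def)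
    then show False using assms(3) by simp
  qed
  define c where "c = - (eval_at (shifted n \<eta>) q / a)"
  have "q + mconst c * p = 0"
  proof (rule vanishing_shifted)
    show "q + mconst c * p \<in> polys_below {1..n} (Suc (weight \<eta>))"
      by (intro polys_below_add polys_below_mconst q_below assms)
    fix \<gamma> assume \<gamma>: "composition n \<gamma>" "weight \<gamma> \<le> weight \<eta>"
    show "eval_at (shifted n \<gamma>) (q + mconst c * p) = 0"
    proof (cases "\<gamma> = \<eta>")
      case True
      then show ?thesis
        using a by (simp add: eval_at_add eval_at_mult eval_at_mconst c_def flip: a_def)
    next
      case False
      then show ?thesis
        using \<gamma> q assms(4) by (simp add: eval_at_add eval_at_mult)
    qed
  qed
  then have "Poly_Mapping.lookup q m + c * Poly_Mapping.lookup p m = 0" for m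
    by (metis lookup_add lookup_mconst_mult lookup_zero)
  moreover from this[of \<eta>] have "c = - 1"
    using q assms(3) by (simp add: add_eq_0_iff)
  ultimately show "q = p"
    by (intro poly_mapping_eqI) (simp add: eq_neg_iff_add_eq_0)
qed

theorem b_coeff_nonneg:
  assumes "composition n \<eta>"
  shows "b_coeff n \<eta> \<gamma> \<in> nonneg_alpha"
proof -
  obtain B where B: "B \<in> polys_below {1..n} (Suc (weight \<eta>))" "range (Poly_Mapping.lookup B) \<subseteq> nonneg_alpha"
    "Poly_Mapping.lookup B \<eta> = hook_product n \<eta> alpha"
    "supported (weight \<eta>) {Poly_Mapping.lookup \<eta>} (\<lambda>v. eval_at (coord v) B)"
    using integral_form[OF assms] by blast
  \<comment> \<open>The coefficient of \<open>B(-alpha x)\<close> at \<open>\<eta>\<close>; dividing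
    by it gives the normalization of E.\<close>
  define c where "c = (- alpha) ^ weight \<eta> * hook_product n \<eta> alpha"
  have c: "c \<noteq> 0"
    using alpha_nonzero by (simp add: c_def hook_product_hooks hooks_nonzero)
  have E: "interp_E n \<eta> = rescale (- alpha) c B"
  proof (rule interp_E_eqI[OF assms])
    have "Poly_Mapping.keys (rescale (- alpha) c B) \<subseteq> Poly_Mapping.keys B"
      by (auto simp: in_keys_iff lookup_rescale)
    then show below: "rescale (- alpha) c B \<in> polys_below {1..n} (Suc (weight \<eta>))"
      using B(1) by (auto simp: polys_below_def)
    show "Poly_Mapping.lookup (rescale (- alpha) c B) \<eta> = 1"
      using c by (simp add: lookup_rescale B(3) flip: c_def)
    fix \<gamma> assume \<gamma>: "composition n \<gamma>" "\<gamma> \<noteq> \<eta>" "weight \<gamma> \<le> weight \<eta>"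
    have "eval_at (shifted n \<gamma>) (rescale (- alpha) c B) = eval_at (coord (node (Poly_Mapping.lookup \<gamma>))) B / c"
      unfolding eval_shifted[OF below] by (simp only: eval_at_rescale target_node)
    also have "\<dots> = 0"
    proof -
      have "Poly_Mapping.lookup \<gamma> \<notin> {Poly_Mapping.lookup \<eta>}"
        using \<gamma>(2) by simp
      moreover have "wt (Poly_Mapping.lookup \<gamma>) \<le> weight \<eta>"
        using \<gamma>(3) weight_wt[OF \<gamma>(1)] by simp
      ultimately show ?thesis
        using B(4) lookup_comps[OF \<gamma>(1)] by (simp add: supported_def)
    qed
    finally show "eval_at (shifted n \<gamma>) (rescale (- alpha) c B) = 0" .
  qed
  have signs: "(- 1) ^ k * ((- alpha) ^ k * x) = alpha ^ k * x" for k x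
    by (simp flip: mult.assoc power_mult_distrib)
  have "hook_product n \<eta> alpha \<noteq> 0" by (simp add: hook_product_hooks hooks_nonzero)
  \<comment> \<open>The signs from \<open>negate_vars\<close> and from the prefactor of F turn the
    powers of -alpha into powers of alpha, and the hook product cancels against
    \<open>c\<close>.\<close>
  then have "Poly_Mapping.lookup (interp_F n \<eta>) \<gamma> * alpha ^ weight \<eta> = alpha ^ weight \<gamma> * Poly_Mapping.lookup B \<gamma>"
    using c alpha_nonzero
    by (simp add: interp_F_def E lookup_mconst_mult lookup_negate_vars lookup_rescale c_def signs
        power_minus[of alpha] field_simps)
  then have "b_coeff n \<eta> \<gamma> = Poly_Mapping.lookup B \<gamma>"
    using alpha_nonzero by (simp add: b_coeff_def power_int_diff field_simps)
  then show ?thesis using B(2) by auto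
qed

end

theorem theoremB:
  fixes n :: nat and \<eta> \<gamma> :: "nat \<Rightarrow>\<^sub>0 nat"
  assumes "n \<ge> 1" and "composition n \<eta>" and "composition n \<gamma>"
  shows "\<exists>p :: nat poly. b_coeff n \<eta> \<gamma> = poly (map_poly of_nat p) alpha"
proof -
  interpret interpolation_dim n
    using assms(1) by unfold_locales
  show ?thesis
    using b_coeff_nonneg[OF assms(2), of \<gamma>] by (auto simp: nonneg_alpha_def)
qed

end
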